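(* Let $0<|q|<1$, let $r,s$ be non-negative integers with $r\le s$, and let $\mathbf a=(a_1,\ldots,a_r)$, $\mathbf b=(b_1,\ldots,b_s)$ be nonzero complex numbers for which all expressions below are defined. Then \begin{align*} &\frac{[a_1,\ldots,a_r]_\infty}{[b_1,\ldots,b_s]_\infty}\bigl(1-\mathcal{S}(\mathbf a)+\mathcal{S}(\mathbf b)\bigr) +\frac{[a_1,\ldots,a_r]_\infty}{[b_1,\ldots,b_s]_\infty}\sum_{\substack{n=-\infty\\ n\neq0}}^{\infty}\frac{(-1)^{(s-r+1)n}q^{(s-r+1)n(n+1)/2-n}}{1-q^n}\left(\frac{a_1\cdots a_r}{b_1\cdots b_s}\right)^n\\ &=\sum_{k=1}^{s}\frac{\prod_{i=1}^r[a_i/b_k]_\infty}{[b_k]_\infty\prod_{j\neq k}[b_j/b_k]_\infty}\sum_{n=-\infty}^{\infty}\frac{(-1)^{(s-r+1)n}q^{(s-r+1)n(n+1)/2-n}}{1-b_kq^n}\left(\frac{a_1\cdots a_r\,b_k^{s-r}}{\prod_{j\neq k}b_j}\right)^n. \end{align*} For $r=s+1$ the same identity holds provided $|q^2|<\left|\frac{a_1\cdots a_r}{b_1\cdots b_s}\right|<|q|$.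
   Context: Notation: $(a;q)_\infty=\prod_{n\ge0}(1-aq^n)$, $[a]_\infty=(a;q)_\infty(q/a;q)_\infty$, $[a_1,\ldots,a_k]_\infty=[a_1]_\infty\cdots[a_k]_\infty$. For a finite sequence $\mathbf a=(a_1,\ldots,a_r)$, $\mathcal{S}(a_1,\ldots,a_r)=\sum_{u=1}^r\sum_{n=0}^\infty\left(\frac{1}{1-a_uq^n}-\frac{1}{1-a_u^{-1}q^{n+1}}\right)$, with $\mathcal S$ of the empty sequence equal to $0$. Products over $j\neq k$ range over $j\in\{1,\ldots,s\}\setminus\{k\}$. *)

theory Defs
  imports "HOL-Analysis.Analysis"
begin

definition qpoch_inf :: "complex \<Rightarrow> complex \<Rightarrow> complex" where
  "qpoch_inf a q = (\<Prod>n. 1 - a * q ^ n)"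

text \<open>The bracket \<open>[a]\<^sub>\<infinity> = (a;q)\<^sub>\<infinity> (q/a;q)\<^sub>\<infinity>\<close>.\<close>

definition qbracket :: "complex \<Rightarrow> complex \<Rightarrow> complex" where
  "qbracket q a = qpoch_inf a q * qpoch_inf (q / a) q"

text \<open>A finite sequence is a length \<open>r\<close> with a function of which only the values on
  \<open>{1..r}\<close> matter. Each summand below is kept as a difference, since neither
  half is summable over \<open>n\<close> on its own.\<close>

definition lambert_S :: "complex \<Rightarrow> nat \<Rightarrow> (nat \<Rightarrow> complex) \<Rightarrow> complex" where
  "lambert_S q r a =
     (\<Sum>u=1..r. \<Sum>n. 1 / (1 - a u * q ^ n) - 1 / (1 - inverse (a u) * q ^ Suc n))"

text \<open>The factor \<open>(-1)\<^bsup>dn\<^esup> q\<^bsup>dn(n+1)/2 - n\<^esup>\<close>, with \<open>d = s - r + 1\<close> in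
  the identity; the integer division is exact because \<open>n(n+1)\<close> is even.\<close>

definition lambert_coeff :: "complex \<Rightarrow> int \<Rightarrow> int \<Rightarrow> complex" where
  "lambert_coeff q d n = (-1) powi (d * n) * q powi (d * (n * (n + 1) div 2) - n)"

end

theory Submission
  imports Defs
begin

text \<open>Put \<open>b\<^sub>0 = 1\<close> and replace every bracket by a truncated theta product, so that
  \<open>t \<Prod>[a\<^sub>i t] / \<Prod>[b\<^sub>j t]\<close> becomes a rational function with simple poles at
  \<open>1 / (b\<^sub>k q\<^sup>n)\<close>, \<open>n\<close> in a window. One of these poles, coming from \<open>(k, n) = (0, 0)\<close>, is
  \<open>t = 1\<close>. Removing its factor \<open>1 - t\<close> and comparing the partial fraction expansion at \<open>t = 1\<close> with
  the logarithmic derivative, where the sums \<open>S\<close> come from, gives a finite form of the identity.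
  By the quasi-periodicity of theta products each residue is a Lambert
  weight times a correction that is bounded uniformly in the window and tends to a quotient of
  brackets, so dominated convergence yields the theorem.\<close>

section \<open>Partial fractions and logarithmic derivatives\<close>

text \<open>The denominators \<open>1 - b_k q^n\<close> of the series are not part of the residues:
  they appear when the other partial fractions are evaluated at \<open>t = 1\<close>. This is why
  the expansion is made at a pole and its constant term compared, that is, the derivative of the
  function times \<open>1 - t\<close>. The single prefactor \<open>t\<close> is the source of the
  \<open>- n\<close> in the exponent of \<open>lambert_coeff\<close>. A window product is a monomial
  in its argument times a product close to a bracket. With \<open>r\<close> windows above and
  \<open>s + 1\<close> below the monomials do not balance, so the numerator also gets
  \<open>t ^ (N * d)\<close> with \<open>d = s + 1 - r\<close>; the same power cancels the part of
  the logarithmic derivative that grows with \<open>N\<close>. The obstacle is uniformity: the poles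
  near the ends of the window move with \<open>N\<close>, and pointwise convergence says nothing
  about them. Hence each residue is computed exactly, as a factor common to all nodes, a weight free
  of \<open>N\<close>, and a bounded quotient of truncated products. For \<open>d = 0\<close> the
  weights have no quadratic exponent, and their summability rests on the annulus for
  \<open>P\<close>.\<close>

lemma partial_fractions_deriv:
  fixes x :: "'i \<Rightarrow> 'a :: real_normed_field" and F :: "'a poly"
  assumes I: "finite I" and inj: "inj_on x I"
    and nz: "\<And>i. i \<in> I \<Longrightarrow> x i \<noteq> 0" and n1: "\<And>i. i \<in> I \<Longrightarrow> x i \<noteq> 1"
    and deg: "degree F \<le> card I"
  shows "((\<lambda>t. poly F t / (\<Prod>i\<in>I. 1 - t * x i)) has_field_derivative
      (\<Sum>i\<in>I. poly F (1 / x i) / ((1 - 1 / x i) * (\<Prod>j\<in>I - {i}. 1 - x j / x i)) * (1 / (x i - 1))))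
      (at 1)"
proof -
  define W where "W = (\<lambda>J t. \<Prod>i\<in>J. 1 - t * x i)"
  define c where "c = (\<lambda>i. poly F (1 / x i) / ((1 - 1 / x i) * (\<Prod>j\<in>I - {i}. 1 - x j / x i)))"
  define V where "V = (\<lambda>J. \<Prod>i\<in>J. [:1, - x i:])"
  \<comment> \<open>Interpolation at the \<open>card I + 1\<close> points \<open>1\<close> and
    \<open>1 / x i\<close>: both polynomials have degree at most \<open>card I\<close>, so agreement
    there forces \<open>F = G\<close>. Dividing by \<open>W I\<close> leaves no polynomial
    part.\<close>
  define G where "G = smult (poly F 1 / W I 1) (V I) + [:1, -1:] * (\<Sum>i\<in>I. smult (c i) (V (I - {i})))"
  have polyV: "poly (V J) t = W J t" for J t
    unfolding V_def W_def by (simp add: poly_prod)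
  have W1: "W I 1 \<noteq> 0"
    unfolding W_def using I n1 by auto
  have W_remove: "W I t = (1 - t * x i) * W (I - {i}) t" if "i \<in> I" for i t
    unfolding W_def using that I by (simp add: prod.remove)
  have polyG: "poly G t = poly F 1 / W I 1 * W I t + (1 - t) * (\<Sum>i\<in>I. c i * W (I - {i}) t)" for t
    unfolding G_def by (simp add: polyV poly_sum left_diff_distrib)
  have degV: "degree (V J) \<le> card J" if "finite J" for J
  proof -
    have "degree (V J) \<le> sum (degree \<circ> (\<lambda>i. [:1, - x i:])) J"
      unfolding V_def by (rule degree_prod_sum_le[OF that])
    also have "\<dots> \<le> (\<Sum>i\<in>J. 1)"
      by (intro sum_mono) simp
    finally show ?thesis by simp
  qed
  have "degree G \<le> card I"
  proof (cases "I = {}")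
    case True
    then show ?thesis by (simp add: G_def V_def)
  next
    case False
    have "degree (\<Sum>i\<in>I. smult (c i) (V (I - {i}))) \<le> card I - 1"
    proof (rule degree_sum_le[OF I])
      fix i assume "i \<in> I"
      then show "degree (smult (c i) (V (I - {i}))) \<le> card I - 1"
        using degV[of "I - {i}"] I degree_smult_le[of "c i" "V (I - {i})"] by simp
    qed
    moreover have "degree ([:1, -1:] :: 'a poly) = 1" by simp
    moreover have "card I > 0" using False I by (simp add: card_gt_0_iff)
    ultimately have "degree ([:1, -1:] * (\<Sum>i\<in>I. smult (c i) (V (I - {i})))) \<le> card I"
      using degree_mult_le[of "[:1, -1:] :: 'a poly" "\<Sum>i\<in>I. smult (c i) (V (I - {i}))"] by linarith
    moreover have "degree (smult (poly F 1 / W I 1) (V I)) \<le> card I"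
      using degV[OF I] degree_smult_le order_trans by blast
    ultimately show ?thesis
      unfolding G_def by (intro degree_add_le)
  qed
  moreover have "poly F t = poly G t" if t: "t \<in> insert 1 ((\<lambda>i. 1 / x i) ` I)" for t
  proof (cases "t = 1")
    case True
    then show ?thesis using W1 by (simp add: polyG)
  next
    case False
    then obtain i where i: "i \<in> I" "t = 1 / x i" using t by auto
    have W0: "W J t = 0" if "i \<in> J" "finite J" for J
      unfolding W_def using that i nz by (simp add: prod_zero_iff) (rule bexI[of _ i], auto)
    have "(\<Sum>j\<in>I. c j * W (I - {j}) t) = c i * W (I - {i}) t + (\<Sum>j\<in>I - {i}. c j * W (I - {j}) t)"
      using I i by (simp add: sum.remove)
    also have "(\<Sum>j\<in>I - {i}. c j * W (I - {j}) t) = 0"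
    proof (rule sum.neutral, rule ballI)
      fix j assume "j \<in> I - {i}"
      then have "W (I - {j}) t = 0" using i(1) I by (intro W0) auto
      then show "c j * W (I - {j}) t = 0" by simp
    qed
    finally have "poly G t = (1 - t) * (c i * W (I - {i}) t)"
      using W0[OF i(1) I] by (simp add: polyG)
    moreover have "W (I - {i}) t = (\<Prod>j\<in>I - {i}. 1 - x j / x i)"
      unfolding W_def i by simp
    moreover have "(\<Prod>j\<in>I - {i}. 1 - x j / x i) \<noteq> 0"
    proof -
      have "x j \<noteq> x i" if "j \<in> I - {i}" for j
        using that i(1) inj_onD[OF inj, of j i] by auto
      then show ?thesis
        using I nz[OF i(1)] by (simp add: divide_eq_eq)
    qed
    moreover have "1 - 1 / x i \<noteq> 0" using nz[OF i(1)] n1[OF i(1)] by (auto simp: divide_eq_eq)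
    ultimately show ?thesis
      using nz[OF i(1)] n1[OF i(1)] unfolding c_def i by simp
  qed
  moreover have "card (insert 1 ((\<lambda>i. 1 / x i) ` I)) = Suc (card I)"
  proof -
    have "inj_on (\<lambda>i. 1 / x i) I"
      by (rule inj_onI) (use inj in \<open>auto dest: inj_onD\<close>)
    moreover have "1 \<notin> (\<lambda>i. 1 / x i) ` I"
      using n1 by auto
    ultimately show ?thesis using I by (simp add: card_image)
  qed
  ultimately have "F = G"
    using deg by (intro poly_eqI_degree[where A = "insert 1 ((\<lambda>i. 1 / x i) ` I)"]) auto
  define h where "h = (\<lambda>t. poly F 1 / W I 1 + (1 - t) * (\<Sum>i\<in>I. c i * (1 / (1 - t * x i))))"
  have eq: "poly F t / W I t = h t" if "W I t \<noteq> 0" for t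
  proof -
    have "c i * W (I - {i}) t / W I t = c i * (1 / (1 - t * x i))" if "i \<in> I" for i
      using \<open>W I t \<noteq> 0\<close> W_remove[OF that, of t] by auto
    then have "(\<Sum>i\<in>I. c i * W (I - {i}) t) / W I t = (\<Sum>i\<in>I. c i * (1 / (1 - t * x i)))"
      by (simp add: sum_divide_distrib)
    moreover have "poly F t / W I t = poly F 1 / W I 1 + (1 - t) * ((\<Sum>i\<in>I. c i * W (I - {i}) t) / W I t)"
      using that polyG[of t] arg_cong[OF \<open>F = G\<close>, of "\<lambda>p. poly p t"] by (simp add: add_divide_distrib)
    ultimately show ?thesis
      unfolding h_def by simp
  qed
  have "continuous (at 1) (W I)"
    unfolding W_def by (intro continuous_intros)
  then have ev: "\<forall>\<^sub>F t in nhds 1. W I t \<noteq> 0"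
    using W1 by (simp add: continuous_at tendsto_nhds_iff tendsto_imp_eventually_ne)
  \<comment> \<open>The value of this derivative does not enter the result: in the product rule it
    is multiplied by \<open>1 - t\<close>, which vanishes at \<open>t = 1\<close>.\<close>
  have "((\<lambda>t. \<Sum>i\<in>I. c i * (1 / (1 - t * x i))) has_field_derivative
          (\<Sum>i\<in>I. c i * (x i / (1 - x i)\<^sup>2))) (at 1)"
  proof (rule DERIV_sum)
    fix i assume "i \<in> I"
    then have "1 - 1 * x i \<noteq> 0" using n1 by auto
    then have "((\<lambda>t. 1 / (1 - t * x i)) has_field_derivative x i / (1 - x i)\<^sup>2) (at 1)"
      by (auto intro!: derivative_eq_intros simp: power2_eq_square)
    then show "((\<lambda>t. c i * (1 / (1 - t * x i))) has_field_derivative c i * (x i / (1 - x i)\<^sup>2)) (at 1)"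
      by (rule DERIV_cmult)
  qed
  then have "((\<lambda>t. (1 - t) * (\<Sum>i\<in>I. c i * (1 / (1 - t * x i)))) has_field_derivative
       (- (\<Sum>i\<in>I. c i * (1 / (1 - x i))))) (at 1)"
    using DERIV_mult[OF DERIV_diff[OF DERIV_const[of 1] DERIV_ident]] by fastforce
  moreover have "- (\<Sum>i\<in>I. c i * (1 / (1 - x i))) = (\<Sum>i\<in>I. c i * (1 / (x i - 1)))"
    unfolding sum_negf[symmetric]
    by (rule sum.cong[OF refl]) (metis minus_diff_eq minus_divide_right mult_minus_right)
  ultimately have "(h has_field_derivative (\<Sum>i\<in>I. c i * (1 / (x i - 1)))) (at 1)"
    unfolding h_def using DERIV_add[OF DERIV_const] by fastforce
  moreover have ev_eq: "\<forall>\<^sub>F t in nhds 1. poly F t / W I t = h t"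
    using ev by eventually_elim (rule eq)
  ultimately have "((\<lambda>t. poly F t / W I t) has_field_derivative (\<Sum>i\<in>I. c i * (1 / (x i - 1)))) (at 1)"
    by (simp only: DERIV_cong_ev[OF refl ev_eq refl])
  then show ?thesis
    unfolding c_def W_def .
qed

text \<open>A factor \<open>1 - t * z\<close> contributes \<open>- z / (1 - z)\<close>, written as
  \<open>1 - 1 / (1 - z)\<close> to match the summands of \<open>lambert_S\<close>; the ones then
  merely count factors.\<close>

lemma ratio_log_deriv:
  fixes x :: "'i \<Rightarrow> 'a :: real_normed_field" and y :: "'j \<Rightarrow> 'a"
  assumes "finite A" "finite I" "\<And>i. i \<in> A \<Longrightarrow> y i \<noteq> 1" "\<And>i. i \<in> I \<Longrightarrow> x i \<noteq> 1"
  shows "((\<lambda>t. t ^ e * (\<Prod>i\<in>A. 1 - t * y i) / (\<Prod>i\<in>I. 1 - t * x i)) has_field_derivative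
    (\<Prod>i\<in>A. 1 - y i) / (\<Prod>i\<in>I. 1 - x i) *
    (of_nat e + (\<Sum>i\<in>A. 1 - 1 / (1 - y i)) - (\<Sum>i\<in>I. 1 - 1 / (1 - x i)))) (at 1)"
proof -
  have D: "((\<lambda>t. \<Prod>i\<in>B. 1 - t * z i) has_field_derivative
      (\<Prod>i\<in>B. 1 - z i) * (\<Sum>i\<in>B. 1 - 1 / (1 - z i))) (at 1)"
    if z: "\<And>i. i \<in> B \<Longrightarrow> z i \<noteq> 1" for B and z :: "'k \<Rightarrow> 'a"
  proof -
    have "((\<lambda>t. \<Prod>i\<in>B. 1 - t * z i) has_field_derivative
        (\<Prod>i\<in>B. 1 - 1 * z i) * (\<Sum>i\<in>B. - z i / (1 - 1 * z i))) (at 1)"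
      by (rule has_field_derivative_prod') (use z in \<open>auto intro!: derivative_eq_intros\<close>)
    moreover have "- z i / (1 - 1 * z i) = 1 - 1 / (1 - z i)" if "i \<in> B" for i
      using z[OF that] by (simp add: field_simps)
    ultimately show ?thesis by simp
  qed
  define PA PI where "PA = (\<Prod>i\<in>A. 1 - y i)" and "PI = (\<Prod>i\<in>I. 1 - x i)"
  have "PI \<noteq> 0"
    unfolding PI_def using assms by auto
  have "((\<lambda>t::'a. t ^ e) has_field_derivative of_nat e) (at 1)"
    by (auto intro!: derivative_eq_intros)
  from DERIV_divide[OF DERIV_mult[OF this D[of A y, OF assms(3)]] D[of I x, OF assms(4)]] \<open>PI \<noteq> 0\<close>
  have "((\<lambda>t. t ^ e * (\<Prod>i\<in>A. 1 - t * y i) / (\<Prod>i\<in>I. 1 - t * x i)) has_field_derivative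
      ((of_nat e * PA + PA * (\<Sum>i\<in>A. 1 - 1 / (1 - y i))) * PI -
        PA * (PI * (\<Sum>i\<in>I. 1 - 1 / (1 - x i)))) / (PI * PI)) (at 1)"
    unfolding PA_def PI_def by simp
  moreover have "((of_nat e * PA + PA * u) * PI - PA * (PI * v)) / (PI * PI) = PA / PI * (of_nat e + u - v)" for u v
    using \<open>PI \<noteq> 0\<close> by (simp add: field_simps)
  ultimately show ?thesis
    unfolding PA_def PI_def by simp
qed

section \<open>Truncated theta products\<close>

definition tri :: "int \<Rightarrow> int" where
  "tri n = n * (n + 1) div 2"

definition qpoch :: "complex \<Rightarrow> complex \<Rightarrow> nat \<Rightarrow> complex" where
  "qpoch a q n = (\<Prod>k<n. 1 - a * q ^ k)"

definition qwin :: "complex \<Rightarrow> complex \<Rightarrow> int \<Rightarrow> int \<Rightarrow> complex" where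
  "qwin q c M L = (\<Prod>m\<in>{-M..<L}. 1 - c * q powi m)"

text \<open>The normalization makes the window product \<open>nwin q c M L\<close> converge to the bracket of
  \<open>c\<close> as \<open>M\<close> and \<open>L\<close> grow.\<close>

definition nwin :: "complex \<Rightarrow> complex \<Rightarrow> int \<Rightarrow> int \<Rightarrow> complex" where
  "nwin q c M L = qwin q c M L / ((-c) powi M * q powi (- tri M))"

lemma two_tri: "2 * tri n = n * (n + 1)"
  unfolding tri_def by (simp add: dvd_mult_div_cancel)

text \<open>The cross term \<open>m * n\<close> separates the size of a window from the position of
  a node; in the residues it is absorbed by the power \<open>t ^ (N * d)\<close>.\<close>

lemma tri_add: "tri (m + n) = tri m + tri n + m * n"
proof -
  have "2 * tri (m + n) = 2 * (tri m + tri n + m * n)"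
    unfolding distrib_left[of 2] two_tri by (simp add: algebra_simps)
  then show ?thesis by simp
qed

lemma tri_0 [simp]: "tri 0 = 0" and tri_1 [simp]: "tri 1 = 1"
  by (simp_all add: tri_def)

text \<open>The new factor has index \<open>-(M + 1)\<close>. Pulling out its dominant monomial
  leaves a factor of \<open>(q/c; q)\<close>; the monomials pulled out accumulate to the
  normalization of \<open>nwin\<close>.\<close>

lemma qwin_Suc_left:
  assumes "q \<noteq> 0" "c \<noteq> 0" "M \<ge> 0" "- M \<le> L"
  shows "qwin q c (M + 1) L = (- c * q powi (- (M + 1))) * (1 - q / c * q ^ nat M) * qwin q c M L"
proof -
  have "{- (M + 1)..<L} = insert (- (M + 1)) {- M..<L}"
    using assms by auto
  moreover have "q ^ nat M = q powi M"
    using assms by (simp add: power_int_def)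
  ultimately show ?thesis
    unfolding qwin_def using assms
    by (simp add: field_simps power_int_minus power_int_add power_int_diff)
qed

lemma nwin_Suc_left:
  assumes "q \<noteq> 0" "c \<noteq> 0" "M \<ge> 0" "- M \<le> L"
  shows "nwin q c (M + 1) L = (1 - q / c * q ^ nat M) * nwin q c M L"
proof -
  have "tri (M + 1) = tri M + M + 1"
    using tri_add[of M 1] by simp
  then show ?thesis
    unfolding nwin_def qwin_Suc_left[OF assms] using assms
    by (simp add: field_simps power_int_minus power_int_add power_int_diff)
qed

lemma nwin_eq:
  assumes "q \<noteq> 0" "c \<noteq> 0"
  shows "nwin q c (int M) (int L) = qpoch c q L * qpoch (q / c) q M"
proof (induction M)
  case 0
  show ?case
  proof (induction L)
    case (Suc L)
    have "{0..<1 + int L} = insert (int L) {0..<int L}" by auto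
    with Suc show ?case by (simp add: nwin_def qwin_def qpoch_def power_int_def mult_ac)
  qed (simp add: nwin_def qwin_def qpoch_def)
next
  case (Suc M)
  then show ?case
    using nwin_Suc_left[OF assms, of "int M" "int L"] by (simp add: qpoch_def add.commute mult_ac)
qed

text \<open>The poles at the right end of the window reach the case \<open>L = -1\<close> for the numerator products,
  which \<open>nwin_eq\<close> does not cover.\<close>

lemma nwin_minus_one:
  assumes "q \<noteq> 0" "c \<noteq> 0"
  shows "nwin q c (1 + int M) (-1) = - (q / c) * qpoch (q ^ 2 / c) q M"
proof (induction M)
  case 0
  show ?case using assms by (simp add: nwin_def qwin_def qpoch_def power_int_minus field_simps)
next
  case (Suc M)
  have "nat (1 + int M) = Suc M" by simp
  with Suc show ?case
    using nwin_Suc_left[OF assms, of "1 + int M" "-1"]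
    by (simp add: qpoch_def add_ac mult_ac power2_eq_square)
qed

text \<open>At a node \<open>1 / (b_k q^n)\<close> the argument of each window carries
  \<open>q powi (- n)\<close>. Before normalization, quasi-periodicity is only this sliding of the
  index range; the power of \<open>c\<close> appears on passing to \<open>nwin\<close>.\<close>

lemma qwin_shift: "qwin q (c * q powi (-n)) M L = qwin q c (M + n) (L - n)" if "q \<noteq> 0"
proof -
  have "(\<Prod>m\<in>{-M..<L}. 1 - c * q powi (-n) * q powi m) = (\<Prod>m\<in>{-(M + n)..<L - n}. 1 - c * q powi m)"
    by (rule prod.reindex_bij_witness[of _ "\<lambda>m. m + n" "\<lambda>m. m - n"])
      (auto simp: power_int_diff power_int_minus that field_simps)
  then show ?thesis unfolding qwin_def .
qed

text \<open>The case \<open>c = 1\<close>, whose factor at index 0 vanishes and is left out. It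
  describes the poles belonging to the same \<open>b k\<close>. The right end is
  \<open>Suc L\<close> so that exactly \<open>L\<close> positive indices occur.\<close>

lemma qwin_punctured:
  assumes "q \<noteq> 0"
  shows "(\<Prod>m\<in>{- int M..<int (Suc L)} - {0}. 1 - q powi m) =
    (-1) powi int M * q powi (- tri (int M)) * (qpoch q q L * qpoch q q M)"
proof (induction M)
  case 0
  show ?case
  proof (induction L)
    case (Suc L)
    have eq: "{- int 0..<int (Suc (Suc L))} - {0} = insert (int (Suc L)) ({- int 0..<int (Suc L)} - {0})"
      by auto
    have "(\<Prod>m\<in>{- int 0..<int (Suc (Suc L))} - {0}. 1 - q powi m) =
        (1 - q ^ Suc L) * (\<Prod>m\<in>{- int 0..<int (Suc L)} - {0}. 1 - q powi m)"
      unfolding eq by (subst prod.insert) (auto simp del: of_nat_Suc simp: power_int_of_nat)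
    then show ?case
      unfolding Suc.IH by (simp add: qpoch_def del: of_nat_Suc)
  next
    case 0
    have "{- int 0..<int (Suc 0)} - {0} = {}" by auto
    then show ?case by (simp only: prod.empty) (simp add: qpoch_def)
  qed
next
  case (Suc M)
  have eq: "{- int (Suc M)..<int (Suc L)} - {0} = insert (- int (Suc M)) ({- int M..<int (Suc L)} - {0})"
    by auto
  have "- tri (int (Suc M)) = - tri (int M) + - int (Suc M)"
    using tri_add[of "int M" 1] by (simp add: add_ac)
  then have tri: "q powi (- tri (int (Suc M))) = q powi (- tri (int M)) * q powi (- int (Suc M))"
    using power_int_add[of q] assms by metis
  have "(1 - q powi (- int (Suc M))) = (-1) * q powi (- int (Suc M)) * (1 - q ^ Suc M)"
    using assms by (simp only: power_int_minus power_int_of_nat) (simp add: field_simps)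
  moreover have "(\<Prod>m\<in>{- int (Suc M)..<int (Suc L)} - {0}. 1 - q powi m) =
      (1 - q powi (- int (Suc M))) * (\<Prod>m\<in>{- int M..<int (Suc L)} - {0}. 1 - q powi m)"
    unfolding eq by (rule prod.insert) auto
  moreover have "(-1 :: complex) powi int (Suc M) = - ((-1) powi int M)"
    by (simp only: power_int_of_nat) simp
  moreover have "qpoch q q (Suc M) = qpoch q q M * (1 - q ^ Suc M)"
    by (simp add: qpoch_def)
  ultimately show ?case
    by (simp only: Suc.IH tri) (simp add: mult_ac)
qed

section \<open>Convergence of the truncated products and zeros of brackets\<close>

lemma qpoch_tendsto:
  assumes "cmod q < 1"
  shows "(\<lambda>n. qpoch a q n) \<longlonglongrightarrow> qpoch_inf a q"
proof -
  have "summable (\<lambda>n. norm ((1 - a * q ^ n) - 1))"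
    using assms by (simp add: norm_mult norm_power summable_mult summable_geometric)
  then have "convergent_prod (\<lambda>n. 1 - a * q ^ n)"
    by (intro abs_convergent_prod_imp_convergent_prod summable_imp_abs_convergent_prod)
  then have "(\<lambda>n. \<Prod>i\<le>n. 1 - a * q ^ i) \<longlonglongrightarrow> qpoch_inf a q"
    unfolding qpoch_inf_def by (rule convergent_prod_LIMSEQ)
  then have "(\<lambda>n. qpoch a q (Suc n)) \<longlonglongrightarrow> qpoch_inf a q"
    unfolding qpoch_def by (simp only: lessThan_Suc_atMost)
  then show ?thesis by (rule LIMSEQ_imp_Suc)
qed

lemma qpoch_inf_factor_nonzero:
  assumes "cmod q < 1" "qpoch_inf a q \<noteq> 0"
  shows "1 - a * q ^ k \<noteq> 0"
proof
  assume "1 - a * q ^ k = 0"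
  then have "\<forall>n>k. qpoch a q n = 0"
    unfolding qpoch_def by auto
  then have "(\<lambda>n. qpoch a q n) \<longlonglongrightarrow> 0"
    by (intro tendsto_eventually eventually_sequentiallyI[of "Suc k"]) auto
  with qpoch_tendsto[OF assms(1), of a] assms(2) show False
    using LIMSEQ_unique by blast
qed

lemma qpoch_inf_shift:
  assumes "cmod q < 1"
  shows "qpoch_inf a q = (1 - a) * qpoch_inf (a * q) q"
proof -
  have "qpoch a q (Suc n) = (1 - a) * qpoch (a * q) q n" for n
    unfolding qpoch_def by (subst prod.lessThan_Suc_shift) (simp add: mult_ac)
  then have "(\<lambda>n. qpoch a q (Suc n)) \<longlonglongrightarrow> (1 - a) * qpoch_inf (a * q) q"
    using tendsto_mult_left[OF qpoch_tendsto[OF assms, of "a * q"], of "1 - a"] by simp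
  with LIMSEQ_Suc[OF qpoch_tendsto[OF assms, of a]] show ?thesis
    by (rule LIMSEQ_unique)
qed

text \<open>Both brackets contain \<open>(b q; q)\<close> and \<open>(q/b; q)\<close> and differ
  only in \<open>1 - 1 / b\<close> against \<open>1 - b\<close>. For \<open>[b_0 / b_k]\<close> with
  \<open>b_0 = 1\<close>, the factor \<open>- 1 / b_k\<close> removes the \<open>1 / b_k\<close>
  left by the residue and carries the sum over \<open>k\<close> to the other side of the
  identity.\<close>

lemma qbracket_inverse:
  assumes "cmod q < 1" "b \<noteq> 0"
  shows "qbracket q (1 / b) = - qbracket q b / b"
proof -
  have "qbracket q (1 / b) = (1 - 1 / b) * (qpoch_inf (q / b) q * qpoch_inf (b * q) q)"
    using qpoch_inf_shift[OF assms(1), of "1 / b"] by (simp add: qbracket_def mult_ac)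
  also have "1 - 1 / b = - (1 - b) / b"
    using assms(2) by (simp add: field_simps)
  also have "\<dots> * (qpoch_inf (q / b) q * qpoch_inf (b * q) q) = - qbracket q b / b"
    unfolding qbracket_def qpoch_inf_shift[OF assms(1), of b]
    by (simp only: times_divide_eq_left times_divide_eq_right mult_minus_left mult_minus_right mult_ac)
  finally show ?thesis .
qed

text \<open>The bracket vanishes at every integer power of \<open>q\<close>: nonnegative
  \<open>m\<close> is covered by \<open>(c; q)\<close>, negative \<open>m\<close> by
  \<open>(q/c; q)\<close>.\<close>

lemma qbracket_factor_nonzero:
  assumes "q \<noteq> 0" "cmod q < 1" "c \<noteq> 0" "qbracket q c \<noteq> 0"
  shows "1 - c * q powi m \<noteq> 0"
proof (cases "m \<ge> 0")
  case True
  then show ?thesis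
    using qpoch_inf_factor_nonzero[OF assms(2), of c "nat m"] assms(4)
    by (simp add: qbracket_def power_int_def)
next
  case False
  then obtain k where k: "m = - int (Suc k)"
    by (metis int_cases not_le of_nat_0_le_iff)
  have "1 - q / c * q ^ k \<noteq> 0"
    using qpoch_inf_factor_nonzero[OF assms(2), of "q / c" k] assms(4) by (simp add: qbracket_def)
  moreover have "c * q powi m * (q / c * q ^ k) = 1"
    using assms(1,3) unfolding k power_int_minus power_int_of_nat by (simp add: field_simps)
  ultimately show ?thesis
    by (metis eq_iff_diff_eq_0 mult_1)
qed

section \<open>Bounds and limits of the window products\<close>

lemma qpoch_bounded:
  assumes "cmod q < 1"
  obtains C where "C > 0" "\<And>n. cmod (qpoch a q n) \<le> C"
  using convergent_imp_Bseq[OF convergentI[OF qpoch_tendsto[OF assms, of a]]]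
  by (auto simp: Bseq_def)

lemma qpoch_inverse_bounded:
  assumes "cmod q < 1" "qpoch_inf a q \<noteq> 0"
  obtains C where "C > 0" "\<And>n. cmod (inverse (qpoch a q n)) \<le> C"
  using convergent_imp_Bseq[OF convergentI[OF tendsto_inverse[OF qpoch_tendsto[OF assms(1)] assms(2)]]]
  by (auto simp: Bseq_def)

lemma nwin_eq_nat:
  assumes "q \<noteq> 0" "c \<noteq> 0" "M \<ge> 0" "L \<ge> 0"
  shows "nwin q c M L = qpoch c q (nat L) * qpoch (q / c) q (nat M)"
  using nwin_eq[OF assms(1,2), of "nat M" "nat L"] assms by simp

text \<open>The two ends of the window truncate two convergent products independently, so each is
  bounded by itself, however the ends are coupled to \<open>N\<close> and \<open>n\<close>. If
  \<open>L = -1\<close>, the condition \<open>0 \<le> M + L\<close> gives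
  \<open>M \<ge> 1\<close>.\<close>

lemma nwin_bounded:
  assumes q: "q \<noteq> 0" "cmod q < 1" and c: "c \<noteq> 0"
  obtains C where "C > 0" "\<And>M L. 0 \<le> M \<Longrightarrow> - 1 \<le> L \<Longrightarrow> 0 \<le> M + L \<Longrightarrow> cmod (nwin q c M L) \<le> C"
proof -
  obtain C1 where C1: "C1 > 0" "\<And>n. cmod (qpoch c q n) \<le> C1"
    using qpoch_bounded[OF q(2)] by blast
  obtain C2 where C2: "C2 > 0" "\<And>n. cmod (qpoch (q / c) q n) \<le> C2"
    using qpoch_bounded[OF q(2)] by blast
  obtain C3 where C3: "C3 > 0" "\<And>n. cmod (qpoch (q ^ 2 / c) q n) \<le> C3"
    using qpoch_bounded[OF q(2)] by blast
  show ?thesis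
  proof (rule that)
    show "0 < C1 * C2 + cmod (q / c) * C3"
      using C1 C2 C3 by (simp add: add_pos_nonneg)
    fix M L :: int
    assume le: "0 \<le> M" "- 1 \<le> L" "0 \<le> M + L"
    show "cmod (nwin q c M L) \<le> C1 * C2 + cmod (q / c) * C3"
    proof (cases "L = -1")
      case True
      define k where "k = nat (M - 1)"
      have k: "M = 1 + int k"
        using le True by (simp add: k_def)
      have "cmod (nwin q c M L) = cmod (q / c) * cmod (qpoch (q ^ 2 / c) q k)"
        unfolding k True nwin_minus_one[OF q(1) c] by (simp add: norm_mult norm_divide)
      also have "\<dots> \<le> cmod (q / c) * C3"
        using C3 by (intro mult_left_mono) auto
      also have "\<dots> \<le> C1 * C2 + cmod (q / c) * C3"
        using C1 C2 by simp
      finally show ?thesis .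
    next
      case False
      then have "cmod (nwin q c M L) = cmod (qpoch c q (nat L)) * cmod (qpoch (q / c) q (nat M))"
        using nwin_eq_nat[OF q(1) c, of M L] le by (simp add: norm_mult)
      also have "\<dots> \<le> C1 * C2"
        using C1 C2 by (intro mult_mono) (auto intro: less_imp_le)
      also have "\<dots> \<le> C1 * C2 + cmod (q / c) * C3"
        using C3 by simp
      finally show ?thesis .
    qed
  qed
qed

text \<open>A nonzero limit makes the inverses converge, hence bounded. The range
  \<open>0 \<le> L\<close> suffices: the two extra indices in the denominator windows keep
  \<open>L = N + 2 - n\<close> positive at every node.\<close>

lemma nwin_inverse_bounded:
  assumes q: "q \<noteq> 0" "cmod q < 1" and c: "c \<noteq> 0" "qbracket q c \<noteq> 0"
  obtains C where "C > 0" "\<And>M L. 0 \<le> M \<Longrightarrow> 0 \<le> L \<Longrightarrow> cmod (inverse (nwin q c M L)) \<le> C"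
proof -
  have nz: "qpoch_inf c q \<noteq> 0" "qpoch_inf (q / c) q \<noteq> 0"
    using c by (auto simp: qbracket_def)
  obtain C1 where C1: "C1 > 0" "\<And>n. cmod (inverse (qpoch c q n)) \<le> C1"
    using qpoch_inverse_bounded[OF q(2) nz(1)] by blast
  obtain C2 where C2: "C2 > 0" "\<And>n. cmod (inverse (qpoch (q / c) q n)) \<le> C2"
    using qpoch_inverse_bounded[OF q(2) nz(2)] by blast
  show ?thesis
  proof (rule that)
    show "0 < C1 * C2" using C1 C2 by simp
    fix M L :: int
    assume le: "0 \<le> M" "0 \<le> L"
    show "cmod (inverse (nwin q c M L)) \<le> C1 * C2"
      unfolding nwin_eq_nat[OF q(1) c(1) le] inverse_mult_distrib norm_mult
      using C1 C2 by (intro mult_mono) (auto intro: less_imp_le)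
  qed
qed

lemma filterlim_nat_add_const: "filterlim (\<lambda>N. nat (int N + n)) at_top sequentially"
  unfolding filterlim_at_top
proof
  fix Z
  show "\<forall>\<^sub>F N in sequentially. Z \<le> nat (int N + n)"
    by (rule eventually_sequentiallyI[of "Z + nat \<bar>n\<bar>"]) linarith
qed

lemma nwin_tendsto:
  assumes q: "q \<noteq> 0" "cmod q < 1" and c: "c \<noteq> 0"
  shows "(\<lambda>N. nwin q c (int N + m) (int N + l)) \<longlonglongrightarrow> qbracket q c"
proof -
  have "(\<lambda>N. qpoch c q (nat (int N + l)) * qpoch (q / c) q (nat (int N + m))) \<longlonglongrightarrow> qbracket q c"
    unfolding qbracket_def
    by (intro tendsto_mult filterlim_compose[OF qpoch_tendsto[OF q(2)]] filterlim_nat_add_const)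
  moreover have ev: "\<forall>\<^sub>F N in sequentially. nwin q c (int N + m) (int N + l) =
      qpoch c q (nat (int N + l)) * qpoch (q / c) q (nat (int N + m))"
    by (rule eventually_sequentiallyI[of "nat \<bar>m\<bar> + nat \<bar>l\<bar>"], rule nwin_eq_nat) (use q c in auto)
  ultimately show ?thesis
    by (simp only: tendsto_cong[OF ev])
qed

lemma qpoch_inf_self_nonzero:
  assumes "cmod q < 1"
  shows "qpoch_inf q q \<noteq> 0"
proof -
  have "summable (\<lambda>n. norm ((1 - q * q ^ n) - 1))"
    using assms by (simp add: norm_mult norm_power summable_mult summable_geometric)
  then have "convergent_prod (\<lambda>n. 1 - q * q ^ n)"
    by (intro abs_convergent_prod_imp_convergent_prod summable_imp_abs_convergent_prod)
  moreover have "1 - q * q ^ n \<noteq> 0" for n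
  proof
    assume "1 - q * q ^ n = 0"
    then have "cmod (q ^ Suc n) = 1" by simp
    then show False
      using assms power_less_one_iff[of "cmod q" "Suc n"] unfolding norm_power by simp
  qed
  ultimately show ?thesis
    unfolding qpoch_inf_def by (rule prodinf_nonzero)
qed

section \<open>Bilateral Lambert series\<close>

text \<open>By the Weierstrass test with majorant \<open>h\<close>, the finite partial sums converge
  uniformly in \<open>N\<close>; this allows the limit over finite sets and the limit in
  \<open>N\<close> to be interchanged.\<close>

lemma infsum_dominated_tendsto:
  fixes g :: "nat \<Rightarrow> 'a \<Rightarrow> 'b :: banach"
  assumes bound: "\<And>N x. x \<in> A \<Longrightarrow> norm (g N x) \<le> h x" and h: "h summable_on A"
    and lim: "\<And>x. x \<in> A \<Longrightarrow> (\<lambda>N. g N x) \<longlonglongrightarrow> G x"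
  shows "(\<lambda>N. \<Sum>\<^sub>\<infinity>x\<in>A. g N x) \<longlonglongrightarrow> (\<Sum>\<^sub>\<infinity>x\<in>A. G x)"
proof -
  have u: "uniform_limit UNIV (\<lambda>X N. \<Sum>x\<in>X. g N x) (\<lambda>N. \<Sum>\<^sub>\<infinity>x\<in>A. g N x) (finite_subsets_at_top A)"
    by (rule Weierstrass_m_test_general[OF _ h]) (rule bound)
  have norm_G: "norm (G x) \<le> h x" if "x \<in> A" for x
    using tendsto_norm[OF lim[OF that]] bound[OF that] by (intro LIMSEQ_le_const2) auto
  have "G abs_summable_on A"
    by (rule summable_on_comparison_test[OF h norm_G]) auto
  then have "(G has_sum (\<Sum>\<^sub>\<infinity>x\<in>A. G x)) A"
    by (rule has_sum_infsum[OF abs_summable_summable])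
  then have "((\<lambda>X. \<Sum>x\<in>X. G x) \<longlongrightarrow> (\<Sum>\<^sub>\<infinity>x\<in>A. G x)) (finite_subsets_at_top A)"
    by (simp add: has_sum_def)
  moreover have ev: "\<forall>\<^sub>F X in finite_subsets_at_top A. (\<lambda>N. \<Sum>x\<in>X. g N x) \<longlonglongrightarrow> (\<Sum>x\<in>X. G x)"
    by (rule eventually_finite_subsets_at_top_weakI) (auto intro!: tendsto_sum lim)
  ultimately show ?thesis
    by (intro swap_uniform_limit'[OF ev _ u]) simp_all
qed

lemma abs_summable_on_int:
  fixes f :: "int \<Rightarrow> 'a :: banach"
  assumes "summable (\<lambda>n. norm (f (int n)))" "summable (\<lambda>n. norm (f (- int n)))"
  shows "f abs_summable_on UNIV"
proof -
  have "(\<lambda>n. norm (f (int n))) summable_on UNIV" "(\<lambda>n. norm (f (- int n))) summable_on UNIV"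
    using assms by (auto intro!: summable_nonneg_imp_summable_on)
  then have "f abs_summable_on range int" "f abs_summable_on range (\<lambda>n. - int n)"
    by (subst summable_on_reindex; simp add: inj_on_def o_def)+
  then have "f abs_summable_on (range int \<union> range (\<lambda>n. - int n))"
    by (rule summable_on_union)
  moreover have "x \<in> range int \<union> range (\<lambda>n. - int n)" for x
    by (cases x rule: int_cases2) auto
  then have "range int \<union> range (\<lambda>n. - int n) = UNIV" by blast
  ultimately show ?thesis by simp
qed

lemma summable_ratio_limit:
  fixes f :: "nat \<Rightarrow> 'a :: {real_normed_field, banach}"
  assumes "\<And>n. n \<ge> N \<Longrightarrow> f (Suc n) = \<rho> n * f n" "\<rho> \<longlonglongrightarrow> l" "norm l < 1"
  shows "summable (\<lambda>n. norm (f n))"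
proof -
  obtain c where c: "norm l < c" "c < 1" using assms(3) dense by blast
  have "\<forall>\<^sub>F n in sequentially. norm (\<rho> n) < c"
    using order_tendstoD(2)[OF tendsto_norm[OF assms(2)] c(1)] .
  then obtain N' where "\<And>n. n \<ge> N' \<Longrightarrow> norm (\<rho> n) < c"
    by (auto simp: eventually_sequentially)
  then have "norm (norm (f (Suc n))) \<le> c * norm (norm (f n))" if "n \<ge> max N N'" for n
    using assms(1)[of n] that by (auto simp: norm_mult intro!: mult_right_mono intro: less_imp_le)
  then show ?thesis
    using c(2) by (rule summable_ratio_test[rotated])
qed

lemma lambert_coeff_Suc:
  assumes "q \<noteq> 0"
  shows "lambert_coeff q (int d) (n + 1) =
    (-1) ^ d * (q powi (int d * (n + 1)) / q) * lambert_coeff q (int d) n"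
proof -
  have "int d * tri (n + 1) - (n + 1) = int d * (n + 1) + -1 + (int d * tri n - n)"
    using tri_add[of n 1] by (simp add: algebra_simps)
  then have "q powi (int d * tri (n + 1) - (n + 1)) =
      q powi (int d * (n + 1)) * q powi (-1) * q powi (int d * tri n - n)"
    using assms by (simp only: power_int_add simp_thms not_False_eq_True)
  moreover have "(-1 :: complex) powi (int d * (n + 1)) = (-1) ^ d * (-1) powi (int d * n)"
    by (simp add: distrib_left power_int_add mult.commute)
  ultimately show ?thesis
    unfolding lambert_coeff_def tri_def[symmetric] by (simp add: field_simps)
qed

text \<open>One form for both kinds of series in the theorem: for \<open>b = 1\<close> the term at
  \<open>n = 0\<close> is 0 because \<open>1 / 0 = 0\<close>, and this is the index omitted
  there.\<close>

definition lambert_term :: "complex \<Rightarrow> nat \<Rightarrow> complex \<Rightarrow> complex \<Rightarrow> int \<Rightarrow> complex" where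
  "lambert_term q d b X n = lambert_coeff q (int d) n / (1 - b * q powi n) * X powi n"

lemma tendsto_power_mult_nat:
  fixes q :: complex
  assumes "cmod q < 1"
  shows "(\<lambda>n. q ^ (d * n)) \<longlonglongrightarrow> (if d = 0 then 1 else 0)"
proof (cases "d = 0")
  case False
  then have "cmod (q ^ d) < 1"
    using assms by (simp add: norm_power power_less_one_iff)
  then show ?thesis
    using False LIMSEQ_power_zero[of "q ^ d"] by (simp add: power_mult)
qed auto

text \<open>For \<open>d > 0\<close> the ratios of consecutive terms tend to 0 in both directions.
  For \<open>d = 0\<close> they tend to \<open>X / q\<close> forwards and to
  \<open>q ^ 2 / X\<close> backwards, and these limits are the origin of the annulus.\<close>

lemma lambert_term_summable:
  assumes q: "q \<noteq> 0" "cmod q < 1" and b: "b \<noteq> 0" and X: "X \<noteq> 0"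
    and nz: "\<And>m. m \<noteq> 0 \<Longrightarrow> 1 - b * q powi m \<noteq> 0"
    and d: "d = 0 \<Longrightarrow> cmod (q ^ 2) < cmod X \<and> cmod X < cmod q"
  shows "(\<lambda>n. norm (lambert_term q d b X n)) summable_on UNIV"
proof (rule abs_summable_on_int)
  have q0: "(\<lambda>n. q ^ n) \<longlonglongrightarrow> 0"
    by (rule LIMSEQ_power_zero[OF q(2)])
  note qS = LIMSEQ_Suc[OF q0]
  show "summable (\<lambda>n. norm (lambert_term q d b X (int n)))"
  proof (rule summable_ratio_limit)
    \<comment> \<open>The recursion starts at 1 because for \<open>b = 1\<close> the term at 0 is
      the default value 0.\<close>
    fix n :: nat assume "n \<ge> 1"
    then have "1 - b * q ^ n \<noteq> 0"
      using nz[of "int n"] by simp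
    have "lambert_coeff q (int d) (int (Suc n)) =
        (-1) ^ d * (q ^ (d * Suc n) / q) * lambert_coeff q (int d) (int n)"
      using lambert_coeff_Suc[OF q(1), of d "int n"]
      by (metis add.commute of_nat_Suc of_nat_mult power_int_of_nat)
    then show "lambert_term q d b X (int (Suc n)) =
        ((-1) ^ d * (q ^ (d * Suc n) / q) * X * ((1 - b * q ^ n) / (1 - b * q ^ Suc n))) *
        lambert_term q d b X (int n)"
      unfolding lambert_term_def power_int_of_nat using \<open>1 - b * q ^ n \<noteq> 0\<close> by simp
  next
    show "(\<lambda>n. (-1) ^ d * (q ^ (d * Suc n) / q) * X * ((1 - b * q ^ n) / (1 - b * q ^ Suc n))) \<longlonglongrightarrow>
        (-1) ^ d * ((if d = 0 then 1 else 0) / q) * X * ((1 - b * 0) / (1 - b * 0))"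
      by (intro tendsto_intros q0 qS LIMSEQ_Suc[OF tendsto_power_mult_nat[OF q(2)]]) (use q in auto)
    show "norm ((-1) ^ d * ((if d = 0 then 1 else 0) / q) * X * ((1 - b * 0) / (1 - b * 0))) < 1"
      using d q by (simp add: norm_mult norm_divide norm_power)
  qed
  show "summable (\<lambda>n. norm (lambert_term q d b X (- int n)))"
  proof (rule summable_ratio_limit)
    fix n :: nat assume "n \<ge> 1"
    then have 1: "1 - b * q powi (- int n) \<noteq> 0" and 2: "1 - b * q powi (- int (Suc n)) \<noteq> 0"
      using nz[of "- int n"] nz[of "- int (Suc n)"] by auto
    \<comment> \<open>In this form the quotient of neighbouring denominators has a limit as
      \<open>q ^ n\<close> tends to 0. It contributes one of the two factors \<open>q\<close> of the
      backward ratio.\<close>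
    have 3: "1 - b * q powi (- int n) = (q ^ n - b) / q ^ n" for n
      using q by (simp only: power_int_minus power_int_of_nat) (simp add: field_simps)
    have nz': "q ^ n - b \<noteq> 0" "q ^ Suc n - b \<noteq> 0"
      using 1 2 unfolding 3 by auto
    have "- int (Suc n) + 1 = - int n" by simp
    then have "lambert_coeff q (int d) (- int n) =
        (-1) ^ d * (q powi (int d * - int n) / q) * lambert_coeff q (int d) (- int (Suc n))"
      using lambert_coeff_Suc[OF q(1), of d "- int (Suc n)"] by metis
    also have "q powi (int d * - int n) = inverse (q ^ (d * n))"
      by (metis mult_minus_right of_nat_mult power_int_minus power_int_of_nat)
    finally have step: "lambert_coeff q (int d) (- int n) =
        (-1) ^ d * (inverse (q ^ (d * n)) / q) * lambert_coeff q (int d) (- int (Suc n))" .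
    have "e * Q * q * (e * (inverse Q / q) * z) = (e * e) * z" if "Q \<noteq> 0" for e Q z
      using that q by (simp add: field_simps)
    then have "(-1) ^ d * q ^ (d * n) * q * lambert_coeff q (int d) (- int n) =
        ((-1) ^ d * (-1) ^ d) * lambert_coeff q (int d) (- int (Suc n))"
      unfolding step using q by (metis power_not_zero)
    then have "lambert_coeff q (int d) (- int (Suc n)) =
        (-1) ^ d * q ^ (d * n) * q * lambert_coeff q (int d) (- int n)"
      by (simp flip: power_mult_distrib)
    moreover have "X powi (- int (Suc n)) = X powi (- int n) / X"
      using X by (simp only: power_int_minus power_int_of_nat) (simp add: field_simps)
    ultimately show "lambert_term q d b X (- int (Suc n)) =
        ((-1) ^ d * q ^ (d * n) * q / X * (q * ((q ^ n - b) / (q ^ Suc n - b)))) * lambert_term q d b X (- int n)"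
      unfolding lambert_term_def 3 using nz' by (simp add: mult_ac)
  next
    show "(\<lambda>n. (-1) ^ d * q ^ (d * n) * q / X * (q * ((q ^ n - b) / (q ^ Suc n - b)))) \<longlonglongrightarrow>
        (-1) ^ d * (if d = 0 then 1 else 0) * q / X * (q * ((0 - b) / (0 - b)))"
      by (intro tendsto_intros q0 qS tendsto_power_mult_nat[OF q(2)]) (use X b in auto)
    show "norm ((-1) ^ d * (if d = 0 then 1 else 0) * q / X * (q * ((0 - b) / (0 - b)))) < 1"
      using d X b by (auto simp: norm_mult norm_divide norm_power power2_eq_square field_simps)
  qed
qed

section \<open>The sums \<open>S\<close> and their windows\<close>

lemma geometric_log_summable:
  fixes c q :: complex
  assumes "cmod q < 1"
  shows "summable (\<lambda>n. 1 / (1 - c * q ^ n) - 1)"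
proof (rule summable_comparison_test_ev)
  have "(\<lambda>n. c * q ^ n) \<longlonglongrightarrow> c * 0"
    by (intro tendsto_intros LIMSEQ_power_zero assms)
  then have "\<forall>\<^sub>F n in sequentially. norm (c * q ^ n) < 1 / 2"
    by (intro order_tendstoD(2)[OF tendsto_norm]) auto
  then show "\<forall>\<^sub>F n in sequentially. norm (1 / (1 - c * q ^ n) - 1) \<le> 2 * cmod c * cmod q ^ n"
  proof eventually_elim
    case (elim n)
    define z where "z = c * q ^ n"
    have z: "cmod (1 - z) \<ge> 1 / 2"
      using elim norm_triangle_ineq2[of 1 z] unfolding z_def by simp
    then have "1 - z \<noteq> 0" by auto
    then have "1 / (1 - z) - 1 = z / (1 - z)"
      by (simp add: field_simps)
    then have "norm (1 / (1 - z) - 1) = cmod z / cmod (1 - z)"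
      by (simp add: norm_divide)
    also have "\<dots> \<le> cmod z / (1 / 2)"
      using z by (intro divide_left_mono) auto
    finally show ?case
      unfolding z_def by (simp add: norm_mult norm_power mult_ac)
  qed
  show "summable (\<lambda>n. 2 * cmod c * cmod q ^ n)"
    using assms by (intro summable_mult summable_geometric) auto
qed

lemma lambert_S_partial:
  assumes "cmod q < 1"
  shows "(\<lambda>N. \<Sum>n<N. 1 / (1 - a * q ^ n) - 1 / (1 - inverse a * q ^ Suc n)) \<longlonglongrightarrow>
    (\<Sum>n. 1 / (1 - a * q ^ n) - 1 / (1 - inverse a * q ^ Suc n))"
proof (rule summable_LIMSEQ)
  have "summable (\<lambda>n. (1 / (1 - a * q ^ n) - 1) - (1 / (1 - inverse a * q ^ Suc n) - 1))"
    using geometric_log_summable[OF assms, of "inverse a * q"]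
    by (intro summable_diff[OF geometric_log_summable[OF assms]]) (simp add: mult_ac)
  then show "summable (\<lambda>n. 1 / (1 - a * q ^ n) - 1 / (1 - inverse a * q ^ Suc n))"
    by simp
qed

text \<open>At a negative index the term is \<open>1 - 1 / (1 - 1 / z)\<close> with
  \<open>z = q ^ Suc n / a\<close>, which equals \<open>1 / (1 - z)\<close>: this produces the
  second half of the summand of \<open>lambert_S\<close>. For \<open>a = 1\<close> the index 0
  causes no harm, since \<open>1 / 0 = 0\<close> is used on both sides.\<close>

lemma sum_log_window:
  fixes q a :: complex
  assumes "q \<noteq> 0" "a \<noteq> 0" and nz: "\<And>n. 1 - inverse a * q ^ Suc n \<noteq> 0"
  shows "(\<Sum>m\<in>{- int N..<int L}. 1 - 1 / (1 - a * q powi m)) =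
    of_nat L - (\<Sum>n<L. 1 / (1 - a * q ^ n)) + (\<Sum>n<N. 1 / (1 - inverse a * q ^ Suc n))"
proof (induction N)
  case 0
  show ?case
  proof (induction L)
    case (Suc L)
    have "{- int 0..<int (Suc L)} = insert (int L) {- int 0..<int L}" by auto
    then have "(\<Sum>m\<in>{- int 0..<int (Suc L)}. 1 - 1 / (1 - a * q powi m)) =
        (1 - 1 / (1 - a * q ^ L)) + (\<Sum>m\<in>{- int 0..<int L}. 1 - 1 / (1 - a * q powi m))"
      by (simp add: power_int_of_nat)
    then show ?case unfolding Suc.IH by simp
  qed simp
next
  case (Suc N)
  have "{- int (Suc N)..<int L} = insert (- int (Suc N)) {- int N..<int L}" by auto
  then have "(\<Sum>m\<in>{- int (Suc N)..<int L}. 1 - 1 / (1 - a * q powi m)) =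
      (1 - 1 / (1 - a * q powi (- int (Suc N)))) + (\<Sum>m\<in>{- int N..<int L}. 1 - 1 / (1 - a * q powi m))"
    by simp
  moreover have "1 - 1 / (1 - a * q powi (- int (Suc N))) = 1 / (1 - inverse a * q ^ Suc N)"
  proof -
    define z where "z = inverse a * q ^ Suc N"
    have "z \<noteq> 0" "1 - z \<noteq> 0"
      using assms nz[of N] unfolding z_def by auto
    moreover have eq: "a * q powi (- int (Suc N)) = 1 / z"
      using assms unfolding z_def power_int_minus power_int_of_nat by (simp add: field_simps)
    ultimately show ?thesis
      unfolding z_def[symmetric] eq by (simp add: field_simps)
  qed
  ultimately show ?case unfolding Suc.IH by (simp add: add_ac)
qed

section \<open>The finite identity\<close>

lemma power_int_prod:
  fixes f :: "'i \<Rightarrow> 'a :: field"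
  shows "(\<Prod>i\<in>A. f i) powi n = (\<Prod>i\<in>A. f i powi n)"
  by (induction A rule: infinite_finite_induct) (auto simp: power_int_mult_distrib)

lemma power_int_power_commute:
  fixes z :: "'a :: field"
  shows "(z powi m) ^ n = (z ^ n) powi m"
  by (induction n) (auto simp: power_int_mult_distrib)

text \<open>Including \<open>b 0 = 1\<close> treats the special series and the sum over
  \<open>k\<close> uniformly. The natural number \<open>d\<close> covers \<open>r \<le> s\<close> as
  \<open>d \<ge> 1\<close> and \<open>r = s + 1\<close> as \<open>d = 0\<close>. Assumption
  \<open>a1\<close> keeps the numerator nonzero at \<open>t = 1\<close>, and \<open>bb\<close> makes
  all poles simple.\<close>

locale lambert_data =
  fixes q :: complex and r s d :: nat and a b :: "nat \<Rightarrow> complex"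
  assumes q0: "q \<noteq> 0" and q1: "cmod q < 1"
    and d: "s + 1 = r + d"
    and a0: "i \<in> {1..r} \<Longrightarrow> a i \<noteq> 0"
    and a1: "i \<in> {1..r} \<Longrightarrow> 1 - a i * q powi m \<noteq> 0"
    and b_0: "b 0 = 1"
    and b0: "k \<in> {0..s} \<Longrightarrow> b k \<noteq> 0"
    and bb: "j \<in> {0..s} \<Longrightarrow> k \<in> {0..s} \<Longrightarrow> j \<noteq> k \<Longrightarrow> qbracket q (b j / b k) \<noteq> 0"
begin

definition P :: complex where
  "P = (\<Prod>i=1..r. a i) / (\<Prod>j=0..s. b j)"

text \<open>Compared with the numerator window \<open>{-N..<N}\<close>, the two additional factors per denominator
  make the degree bound \<open>degree_F\<close> hold even for \<open>d = 0\<close>.\<close>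

definition J :: "nat \<Rightarrow> int set" where
  "J N = {- int N..<int (N + 2)}"

definition I :: "nat \<Rightarrow> (nat \<times> int) set" where
  "I N = {0..s} \<times> J N - {(0, 0)}"

definition x :: "nat \<times> int \<Rightarrow> complex" where
  "x p = b (fst p) * q powi snd p"

text \<open>The power \<open>N * d\<close> offsets the monomials of the \<open>r\<close> numerator
  and \<open>s + 1\<close> denominator windows, each of left length \<open>N\<close>; the remaining
  single \<open>t\<close> is the prefactor of the theta quotient.\<close>

definition F :: "nat \<Rightarrow> complex poly" where
  "F N = monom 1 (1 + N * d) * (\<Prod>p\<in>{1..r} \<times> {- int N..<int N}. [:1, - (a (fst p) * q powi snd p):])"

text \<open>The correction in the residue at node \<open>(k, n)\<close>: shifted windows for the
  numerator, for the rows \<open>j\<close> other than \<open>k\<close>, and the punctured window of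
  row \<open>k\<close> itself.\<close>

definition E :: "nat \<Rightarrow> nat \<Rightarrow> int \<Rightarrow> complex" where
  "E N k n = (\<Prod>i=1..r. nwin q (a i / b k) (int N + n) (int N - n)) /
     ((\<Prod>j\<in>{0..s} - {k}. nwin q (b j / b k) (int N + n) (int (N + 2) - n)) *
      (qpoch q q (nat (int (N + 1) - n)) * qpoch q q (nat (int N + n))))"

text \<open>The part of the residue that depends on \<open>N\<close> alone. It also occurs in the
  value at \<open>t = 1\<close>, so it cancels before the limit is taken.\<close>

definition \<kappa> :: "nat \<Rightarrow> complex" where
  "\<kappa> N = ((-1) ^ N * q powi tri (int N)) ^ d * P ^ N"

lemma P_nonzero: "P \<noteq> 0"
  unfolding P_def using a0 b0 by simp

lemma \<kappa>_nonzero: "\<kappa> N \<noteq> 0"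
  unfolding \<kappa>_def using P_nonzero q0 by simp

lemma q_powi_neq_1: "q powi n \<noteq> 1" if "n \<noteq> 0"
proof
  assume *: "q powi n = 1"
  have "cmod (q powi int (nat \<bar>n\<bar>)) = 1"
  proof (cases "n \<ge> 0")
    case False
    then have "q powi int (nat \<bar>n\<bar>) = inverse (q powi n)"
      by (simp flip: power_int_minus)
    then show ?thesis using * by simp
  qed (use * in simp)
  then have "cmod q ^ nat \<bar>n\<bar> = 1"
    by (simp only: power_int_of_nat norm_power)
  moreover have "cmod q ^ nat \<bar>n\<bar> < 1"
    using that q1 by (subst power_less_one_iff) auto
  ultimately show False by simp
qed

text \<open>Coincidence would make \<open>b j / b k\<close> an integer power of \<open>q\<close>,
  hence a zero of its bracket, or, for \<open>j = k\<close>, a nonzero power of \<open>q\<close>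
  equal to 1.\<close>

lemma x_distinct:
  assumes "p \<in> {0..s} \<times> UNIV" "p' \<in> {0..s} \<times> UNIV" "p \<noteq> p'"
  shows "x p \<noteq> x p'"
proof
  assume eq: "x p = x p'"
  obtain j m k n where p: "p = (j, m)" "p' = (k, n)" by fastforce
  have jk: "j \<in> {0..s}" "k \<in> {0..s}" using assms p by auto
  have "b j / b k * q powi (m - n) = 1"
    using eq b0[OF jk(1)] b0[OF jk(2)] q0 unfolding x_def p by (simp add: power_int_diff field_simps)
  moreover have "b j / b k * q powi (m - n) \<noteq> 1"
  proof (cases "j = k")
    case True
    then show ?thesis
      using assms p q_powi_neq_1[of "m - n"] b0[OF jk(1)] by simp
  next
    case False
    then have "1 - b j / b k * q powi (m - n) \<noteq> 0"
      using jk by (intro qbracket_factor_nonzero q0 q1 bb) (auto simp: b0)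
    then show ?thesis by auto
  qed
  ultimately show False by simp
qed

lemma x_nonzero: "p \<in> {0..s} \<times> UNIV \<Longrightarrow> x p \<noteq> 0"
  unfolding x_def using q0 b0 by auto

lemma x_00: "x (0, 0) = 1"
  unfolding x_def by (simp add: b_0)

lemma finite_I: "finite (I N)"
  unfolding I_def J_def by simp

lemma I_subset: "I N \<subseteq> {0..s} \<times> UNIV"
  unfolding I_def by auto

lemma x_neq_1: "p \<in> I N \<Longrightarrow> x p \<noteq> 1"
  using x_distinct[of p "(0, 0)"] unfolding x_00 I_def by auto

lemma inj_x: "inj_on x (I N)"
  by (rule inj_onI) (use x_distinct I_subset in blast)

lemma degree_F: "degree (F N) \<le> card (I N)"
proof -
  let ?A = "{1..r} \<times> {- int N..<int N}"
  have "degree (\<Prod>p\<in>?A. [:1, - (a (fst p) * q powi snd p):]) \<le>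
      sum (degree \<circ> (\<lambda>p. [:1, - (a (fst p) * q powi snd p):])) ?A"
    by (rule degree_prod_sum_le) simp
  also have "\<dots> \<le> (\<Sum>p\<in>?A. 1)"
    by (intro sum_mono) simp
  also have "\<dots> = r * (2 * N)"
    by (simp add: card_cartesian_product nat_mult_distrib)
  finally have "degree (F N) \<le> 1 + N * d + r * (2 * N)"
    unfolding F_def by (intro order_trans[OF degree_mult_le] add_mono degree_monom_le)
  have card: "card (I N) = (s + 1) * (2 * N + 2) - 1"
    unfolding I_def J_def by (subst card_Diff_singleton) (auto simp: card_cartesian_product nat_add_distrib nat_mult_distrib algebra_simps)
  note \<open>degree (F N) \<le> 1 + N * d + r * (2 * N)\<close>
  also have "1 + N * d + r * (2 * N) \<le> card (I N)"
  proof -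
    have "(s + 1) * (2 * N + 2) = r * (2 * N) + N * d + (N * d + 2 * r + 2 * d)"
      unfolding d by (simp add: algebra_simps)
    \<comment> \<open>Here \<open>2 * r + 2 * d = 2 * (s + 1)\<close>, the contribution of the two
      extra indices per row. The bound is attained for \<open>r = 1\<close>,
      \<open>d = 0\<close>.\<close>
    moreover have "2 \<le> N * d + 2 * r + 2 * d"
      using d by simp
    ultimately show ?thesis
      using card by linarith
  qed
  finally show ?thesis .
qed

lemma poly_F: "poly (F N) t = t ^ (1 + N * d) * (\<Prod>p\<in>{1..r} \<times> {- int N..<int N}. 1 - t * (a (fst p) * q powi snd p))"
  unfolding F_def by (simp add: poly_monom poly_prod)

section \<open>Exact evaluation of the residues\<close>

lemma qwin_eq_nwin: "c \<noteq> 0 \<Longrightarrow> qwin q c M L = nwin q c M L * ((-1) powi M * q powi (- tri M) * c powi M)"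
  unfolding nwin_def using q0 by (simp add: power_int_mult_distrib[of "-1" c, simplified])

lemma qwin_shift_eq:
  assumes "c \<noteq> 0"
  shows "qwin q (c * q powi (- n)) M L =
    nwin q c (M + n) (L - n) * ((-1) powi (M + n) * q powi (- tri (M + n)) * c powi (M + n))"
  unfolding qwin_shift[OF q0] by (rule qwin_eq_nwin[OF assms])

lemma poly_F_at_node:
  assumes k: "k \<in> {0..s}"
  shows "poly (F N) (1 / x (k, n)) = (1 / x (k, n)) ^ (1 + N * d) *
    ((\<Prod>i=1..r. nwin q (a i / b k) (int N + n) (int N - n)) *
     (((-1) powi (int N + n) * q powi (- tri (int N + n))) ^ r * ((\<Prod>i=1..r. a i) / b k ^ r) powi (int N + n)))"
proof -
  have "(\<Prod>p\<in>{1..r} \<times> {- int N..<int N}. 1 - 1 / x (k, n) * (a (fst p) * q powi snd p)) =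
      (\<Prod>i=1..r. qwin q (a i / b k * q powi (- n)) (int N) (int N))"
    unfolding qwin_def prod.cartesian_product x_def using q0
    by (intro prod.cong) (auto simp: power_int_minus field_simps)
  also have "\<dots> = (\<Prod>i=1..r. nwin q (a i / b k) (int N + n) (int N - n) *
      (((-1) powi (int N + n) * q powi (- tri (int N + n))) * (a i / b k) powi (int N + n)))"
    using a0 b0[OF k] by (intro prod.cong refl qwin_shift_eq) simp
  also have "\<dots> = (\<Prod>i=1..r. nwin q (a i / b k) (int N + n) (int N - n)) *
     (((-1) powi (int N + n) * q powi (- tri (int N + n))) ^ r * ((\<Prod>i=1..r. a i) / b k ^ r) powi (int N + n))"
    by (simp add: prod.distrib prod_constant prod_dividef power_int_divide_distrib power_int_prod power_int_power_commute)
  finally show ?thesis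
    unfolding poly_F by simp
qed

lemma denominator_at_node:
  assumes k: "k \<in> {0..s}" and n: "n \<in> J N"
  shows "(\<Prod>p\<in>{0..s} \<times> J N - {(k, n)}. 1 - x p / x (k, n)) =
    ((\<Prod>j\<in>{0..s} - {k}. nwin q (b j / b k) (int N + n) (int (N + 2) - n)) *
      (qpoch q q (nat (int (N + 1) - n)) * qpoch q q (nat (int N + n)))) *
    (((-1) powi (int N + n) * q powi (- tri (int N + n))) ^ (s + 1) *
     ((\<Prod>j=0..s. b j) / b k ^ (s + 1)) powi (int N + n))"
proof -
  define Z where "Z = (-1) powi (int N + n) * q powi (- tri (int N + n))"
  have "{0..s} \<times> J N - {(k, n)} = ({0..s} - {k}) \<times> J N \<union> {k} \<times> (J N - {n})"
    using k by auto
  moreover have "finite (J N)" by (simp add: J_def)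
  ultimately have "(\<Prod>p\<in>{0..s} \<times> J N - {(k, n)}. 1 - x p / x (k, n)) =
      (\<Prod>p\<in>({0..s} - {k}) \<times> J N. 1 - x p / x (k, n)) * (\<Prod>p\<in>{k} \<times> (J N - {n}). 1 - x p / x (k, n))"
    by (simp only:) (rule prod.union_disjoint, auto)
  also have "(\<Prod>p\<in>({0..s} - {k}) \<times> J N. 1 - x p / x (k, n)) =
      (\<Prod>j\<in>{0..s} - {k}. qwin q (b j / b k * q powi (- n)) (int N) (int (N + 2)))"
    unfolding qwin_def prod.cartesian_product x_def J_def using q0
    by (intro prod.cong) (auto simp: power_int_minus field_simps)
  also have "\<dots> = (\<Prod>j\<in>{0..s} - {k}. nwin q (b j / b k) (int N + n) (int (N + 2) - n) *
      (Z * (b j / b k) powi (int N + n)))"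
    unfolding Z_def using b0 k
    by (intro prod.cong refl qwin_shift_eq) auto
  also have "\<dots> = (\<Prod>j\<in>{0..s} - {k}. nwin q (b j / b k) (int N + n) (int (N + 2) - n)) *
      (Z ^ s * ((\<Prod>j\<in>{0..s} - {k}. b j) / b k ^ s) powi (int N + n))"
    using k by (simp add: prod.distrib prod_constant prod_dividef power_int_divide_distrib power_int_prod power_int_power_commute)
  \<comment> \<open>Extending the product to \<open>j = k\<close> adds one factor \<open>b k\<close>
    above and one below, so the weight becomes symmetric in all \<open>b j\<close>.\<close>
  also have "(\<Prod>j\<in>{0..s} - {k}. b j) / b k ^ s = (\<Prod>j=0..s. b j) / b k ^ (s + 1)"
    using k b0[OF k] by (simp add: prod.remove)
  also have "(\<Prod>p\<in>{k} \<times> (J N - {n}). 1 - x p / x (k, n)) = (\<Prod>m\<in>J N - {n}. 1 - q powi (m - n))"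
  proof -
    have "(\<Prod>p\<in>{k} \<times> (J N - {n}). 1 - x p / x (k, n)) =
        (\<Prod>m\<in>J N - {n}. 1 - x (k, m) / x (k, n))"
      by (rule prod.reindex_bij_witness[of _ "\<lambda>m. (k, m)" snd]) auto
    then show ?thesis
      using b0[OF k] q0 by (simp add: x_def power_int_diff)
  qed
  \<comment> \<open>Recentred at the pole, row \<open>k\<close> has indices from
    \<open>-(N + n)\<close> to \<open>N + 1 - n\<close>, with 0 missing.\<close>
  also have "\<dots> = (\<Prod>m\<in>{- int (nat (int N + n))..<int (Suc (nat (int (N + 1) - n)))} - {0}. 1 - q powi m)"
    using n by (intro prod.reindex_bij_witness[of _ "\<lambda>m. m + n" "\<lambda>m. m - n"]) (auto simp: J_def)
  also have "\<dots> = Z * (qpoch q q (nat (int (N + 1) - n)) * qpoch q q (nat (int N + n)))"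
    unfolding qwin_punctured[OF q0] Z_def using n by (simp add: J_def)
  finally show ?thesis
    unfolding Z_def[symmetric] by (simp add: mult_ac)
qed

text \<open>The factors \<open>Z\<close> leave \<open>Z\<close> to the power \<open>- d\<close>,
  whose cross term \<open>q powi (N * n * d)\<close> cancels against
  \<open>(1 / x (k, n)) ^ (N * d)\<close>. The one remaining factor \<open>1 / x (k, n)\<close>
  supplies \<open>q powi (- n)\<close> and \<open>1 / b k\<close>.\<close>

lemma weight_at_node:
  fixes N :: nat and n :: int
  assumes k: "k \<in> {0..s}"
  defines "Z \<equiv> (-1) powi (int N + n) * q powi (- tri (int N + n))"
  shows "(1 / x (k, n)) ^ (1 + N * d) * (Z ^ r * ((\<Prod>i=1..r. a i) / b k ^ r) powi (int N + n)) /
    (Z ^ (s + 1) * ((\<Prod>j=0..s. b j) / b k ^ (s + 1)) powi (int N + n)) =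
    \<kappa> N * (lambert_coeff q (int d) n * (P * b k ^ d) powi n / b k)"
proof -
  define u g t z where "u = q powi n" and "g = (-1 :: complex) powi n" and "t = q powi tri n"
    and "z = (-1 :: complex) ^ N * q powi tri (int N)"
  define \<beta> where "\<beta> = b k"
  define W where "W = (P * \<beta> ^ d) powi n"
  have \<beta>: "\<beta> \<noteq> 0" and u: "u \<noteq> 0"
    using b0[OF k] q0 by (auto simp: \<beta>_def u_def)
  have Z: "Z \<noteq> 0" unfolding Z_def using q0 by simp
  have "(\<Prod>i=1..r. a i) / \<beta> ^ r / ((\<Prod>j=0..s. b j) / \<beta> ^ (s + 1)) = P * \<beta> ^ d"
    unfolding P_def d using \<beta> by (simp add: power_add field_simps)
  then have 1: "((\<Prod>i=1..r. a i) / \<beta> ^ r) powi (int N + n) / ((\<Prod>j=0..s. b j) / \<beta> ^ (s + 1)) powi (int N + n) =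
      (P * \<beta> ^ d) powi (int N + n)"
    by (simp flip: power_int_divide_distrib)
  have 2: "(P * \<beta> ^ d) powi (int N + n) = P ^ N * \<beta> ^ (N * d) * W"
    unfolding W_def using P_nonzero \<beta>
    by (simp add: power_int_add power_mult_distrib power_mult[symmetric] mult.commute[of d N])
  have "q powi (tri (int N + n)) = q powi tri (int N) * t * u ^ N"
    unfolding tri_add t_def u_def using q0
    by (simp add: power_int_add power_int_power_commute power_int_mult mult.commute)
  moreover have "inverse Z = (-1) powi (int N + n) * q powi (tri (int N + n))"
    unfolding Z_def using q0 by (simp add: power_int_minus power_int_inverse[symmetric])
  ultimately have 3: "inverse Z = z * g * t * u ^ N"
    unfolding z_def g_def by (simp add: power_int_add)
  have 4: "lambert_coeff q (int d) n = (g * t) ^ d / u"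
    unfolding lambert_coeff_def tri_def[symmetric] g_def t_def u_def using q0
    by (simp add: power_int_diff power_mult_distrib power_int_mult power_int_power_commute)
  have "Z ^ r * A / (Z ^ (s + 1) * B) = (inverse Z) ^ d * (A / B)" for A B
    unfolding d using Z by (simp add: power_add field_simps)
  from this[of "((\<Prod>i=1..r. a i) / \<beta> ^ r) powi (int N + n)" "((\<Prod>j=0..s. b j) / \<beta> ^ (s + 1)) powi (int N + n)"]
  have 5: "Z ^ r * ((\<Prod>i=1..r. a i) / \<beta> ^ r) powi (int N + n) /
      (Z ^ (s + 1) * ((\<Prod>j=0..s. b j) / \<beta> ^ (s + 1)) powi (int N + n)) =
      (z * g * t * u ^ N) ^ d * (P ^ N * \<beta> ^ (N * d) * W)"
    unfolding 1 2 3 .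
  have "x (k, n) = \<beta> * u"
    by (simp add: x_def \<beta>_def u_def)
  then have "(1 / x (k, n)) ^ (1 + N * d) * (Z ^ r * ((\<Prod>i=1..r. a i) / \<beta> ^ r) powi (int N + n) /
      (Z ^ (s + 1) * ((\<Prod>j=0..s. b j) / \<beta> ^ (s + 1)) powi (int N + n))) =
      (1 / (\<beta> * u)) ^ (1 + N * d) * ((z * g * t * u ^ N) ^ d * (P ^ N * \<beta> ^ (N * d) * W))"
    unfolding 5 by simp
  also have "\<dots> = z ^ d * P ^ N * ((g * t) ^ d / u * W / \<beta>)"
    using u \<beta> by (simp add: power_mult_distrib power_add power_divide power_mult[symmetric] mult_ac)
  finally show ?thesis
    unfolding \<kappa>_def 4 z_def[symmetric] W_def[symmetric] \<beta>_def[symmetric] times_divide_eq_right[of "(1 / x (k, n)) ^ (1 + N * d)"] .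
qed

lemma residue_at_node:
  assumes k: "k \<in> {0..s}" and n: "n \<in> J N"
  shows "poly (F N) (1 / x (k, n)) / (\<Prod>p\<in>{0..s} \<times> J N - {(k, n)}. 1 - x p / x (k, n)) =
    \<kappa> N * (lambert_coeff q (int d) n * (P * b k ^ d) powi n / b k) * E N k n"
proof -
  have "X * (A * B) / (C * D) = (X * B / D) * (A / C)" for X A B C D :: complex
    by (simp add: mult_ac)
  then show ?thesis
    unfolding poly_F_at_node[OF k] denominator_at_node[OF assms] E_def weight_at_node[OF k, symmetric] .
qed

definition logder :: "nat \<Rightarrow> complex" where
  "logder N = of_nat (1 + N * d) + (\<Sum>p\<in>{1..r} \<times> {- int N..<int N}. 1 - 1 / (1 - a (fst p) * q powi snd p))
     - (\<Sum>p\<in>I N. 1 - 1 / (1 - x p))"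

lemma zero_in_J: "0 \<in> J N"
  by (simp add: J_def)

lemma finite_J: "finite (J N)"
  by (simp add: J_def)

text \<open>Both sides are the derivative at \<open>t = 1\<close> of one rational function, by
  \<open>ratio_log_deriv\<close> and by \<open>partial_fractions_deriv\<close>, divided by the
  common factor \<open>\<kappa> N\<close>.\<close>

lemma finite_identity:
  "E N 0 0 * logder N =
    - (\<Sum>k=0..s. (1 / b k) * (\<Sum>n\<in>J N. lambert_term q d (b k) (P * b k ^ d) n * E N k n))"
proof -
  define A where "A = {1..r} \<times> {- int N..<int N}"
  define y where "y = (\<lambda>p. a (fst p) * q powi snd p)"
  define h where "h = (\<lambda>(k, n). lambert_term q d (b k) (P * b k ^ d) n / b k * E N k n)"
  have y: "y p \<noteq> 1" if "p \<in> A" for p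
    using that a1[of "fst p" "snd p"] unfolding A_def y_def by auto
  have "((\<lambda>t. poly (F N) t / (\<Prod>p\<in>I N. 1 - t * x p)) has_field_derivative
      (\<Prod>p\<in>A. 1 - y p) / (\<Prod>p\<in>I N. 1 - x p) * logder N) (at 1)"
    using ratio_log_deriv[of A "I N" y x "1 + N * d"] y finite_I x_neq_1
    unfolding poly_F logder_def A_def y_def by simp
  moreover have "((\<lambda>t. poly (F N) t / (\<Prod>p\<in>I N. 1 - t * x p)) has_field_derivative
      (\<Sum>p\<in>I N. poly (F N) (1 / x p) / ((1 - 1 / x p) * (\<Prod>p'\<in>I N - {p}. 1 - x p' / x p)) * (1 / (x p - 1)))) (at 1)"
    using I_subset by (intro partial_fractions_deriv finite_I inj_x x_nonzero x_neq_1 degree_F) auto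
  ultimately have "(\<Prod>p\<in>A. 1 - y p) / (\<Prod>p\<in>I N. 1 - x p) * logder N =
      (\<Sum>p\<in>I N. poly (F N) (1 / x p) / ((1 - 1 / x p) * (\<Prod>p'\<in>I N - {p}. 1 - x p' / x p)) * (1 / (x p - 1)))"
    by (rule DERIV_unique)
  also have "\<dots> = (\<Sum>p\<in>I N. - \<kappa> N * h p)"
  proof (rule sum.cong[OF refl])
    fix p assume p: "p \<in> I N"
    obtain k n where kn: "p = (k, n)" by fastforce
    have k: "k \<in> {0..s}" and n: "n \<in> J N"
      using p unfolding kn I_def by auto
    \<comment> \<open>The factor \<open>1 - 1 / x p\<close> in the expansion is the one belonging to
      the removed node \<open>(0, 0)\<close>, where \<open>x\<close> is 1.\<close>
    have "{0..s} \<times> J N - {p} = insert (0, 0) (I N - {p})"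
      using p zero_in_J unfolding I_def by auto
    then have "(1 - 1 / x p) * (\<Prod>p'\<in>I N - {p}. 1 - x p' / x p) = (\<Prod>p'\<in>{0..s} \<times> J N - {p}. 1 - x p' / x p)"
      using finite_I[of N] by (simp add: x_00 I_def)
    then have "poly (F N) (1 / x p) / ((1 - 1 / x p) * (\<Prod>p'\<in>I N - {p}. 1 - x p' / x p)) =
        \<kappa> N * (lambert_coeff q (int d) n * (P * b k ^ d) powi n / b k) * E N k n"
      using residue_at_node[OF k n] unfolding kn by simp
    moreover have "1 / (x p - 1) = - (1 / (1 - b k * q powi n))"
      unfolding kn x_def by (metis fst_conv snd_conv minus_diff_eq minus_divide_right)
    ultimately show "poly (F N) (1 / x p) / ((1 - 1 / x p) * (\<Prod>p'\<in>I N - {p}. 1 - x p' / x p)) * (1 / (x p - 1)) =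
        - \<kappa> N * h p"
      unfolding h_def kn lambert_term_def by (simp add: mult_ac)
  qed
  also have "\<dots> = - \<kappa> N * (\<Sum>p\<in>I N. h p)"
    by (simp add: sum_distrib_left)
  also have "(\<Sum>p\<in>I N. h p) = (\<Sum>p\<in>{0..s} \<times> J N. h p)"
    unfolding I_def using finite_J \<comment> \<open>\<open>h (0, 0) = 0\<close> because of \<open>1 / 0 = 0\<close>\<close>
    by (intro sum.mono_neutral_left) (auto simp: h_def lambert_term_def b_0)
  also have "\<dots> = (\<Sum>k=0..s. (1 / b k) * (\<Sum>n\<in>J N. lambert_term q d (b k) (P * b k ^ d) n * E N k n))"
    unfolding h_def sum.cartesian_product[symmetric] sum_distrib_left by (simp add: mult_ac)
  finally have *: "(\<Prod>p\<in>A. 1 - y p) / (\<Prod>p\<in>I N. 1 - x p) * logder N = - \<kappa> N * \<dots>" .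
  \<comment> \<open>The value at \<open>t = 1\<close> is the residue formula at the node
    \<open>(0, 0)\<close>, where the weight is 1.\<close>
  have "(\<Prod>p\<in>A. 1 - y p) / (\<Prod>p\<in>I N. 1 - x p) = \<kappa> N * E N 0 0"
    using residue_at_node[of 0 0 N] zero_in_J
    by (simp add: x_00 b_0 poly_F A_def y_def I_def lambert_coeff_def)
  with * have "\<kappa> N * (E N 0 0 * logder N) = \<kappa> N *
      - (\<Sum>k=0..s. (1 / b k) * (\<Sum>n\<in>J N. lambert_term q d (b k) (P * b k ^ d) n * E N k n))"
    by (simp only: mult.assoc mult_minus_left mult_minus_right)
  then show ?thesis
    unfolding mult_left_cancel[OF \<kappa>_nonzero] .
qed

section \<open>Passage to the limit\<close>

lemma node_factor_nonzero: "k \<in> {0..s} \<Longrightarrow> m \<noteq> 0 \<Longrightarrow> 1 - b k * q powi m \<noteq> 0"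
proof -
  assume k: "k \<in> {0..s}" and m: "m \<noteq> 0"
  show ?thesis
  proof (cases "k = 0")
    case True
    then show ?thesis using q_powi_neq_1[OF m] by (simp add: b_0)
  next
    case False
    then show ?thesis using x_distinct[of "(k, m)" "(0, 0)"] k by (simp add: x_00) (simp add: x_def)
  qed
qed

lemma reflected_factor_nonzero:
  assumes "c \<noteq> 0" "\<And>m. m \<noteq> 0 \<Longrightarrow> 1 - c * q powi m \<noteq> 0"
  shows "1 - inverse c * q ^ Suc n \<noteq> 0"
proof
  assume "1 - inverse c * q ^ Suc n = 0"
  then have "c = q ^ Suc n"
    using assms(1) by (simp add: field_simps)
  then have "1 - c * q powi (- int (Suc n)) = 0"
    using q0 by (simp only: power_int_minus power_int_of_nat) (simp add: field_simps)
  then show False using assms(2)[of "- int (Suc n)"] by simp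
qed

section \<open>The limit of the logarithmic derivative\<close>

definition S_part :: "complex \<Rightarrow> nat \<Rightarrow> complex" where
  "S_part c N = (\<Sum>n<N. 1 / (1 - c * q ^ n) - 1 / (1 - inverse c * q ^ Suc n))"

text \<open>The sum telescopes, and its initial term \<open>1 / (1 - q ^ 0)\<close> is 0 by
  convention. The limit \<open>-1\<close> is the share of \<open>b 0\<close>; it turns the constant
  2 of \<open>logder_eq\<close> into the 1 of the theorem.\<close>

lemma S_part_one: "S_part 1 N = - (1 / (1 - q ^ N))"
proof -
  have "S_part 1 N = (\<Sum>n<N. 1 / (1 - q ^ n) - 1 / (1 - q ^ Suc n))"
    unfolding S_part_def by simp
  also have "\<dots> = 1 / (1 - q ^ 0) - 1 / (1 - q ^ N)"
    by (rule sum_lessThan_telescope')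
  finally show ?thesis by simp
qed

text \<open>The bracket in the second equation comes from the extra indices \<open>N\<close> and
  \<open>N + 1\<close>; it tends to \<open>2 - 1 - 1 = 0\<close>.\<close>

lemma log_window_eq:
  assumes "c \<noteq> 0" "\<And>m. m \<noteq> 0 \<Longrightarrow> 1 - c * q powi m \<noteq> 0"
  shows "(\<Sum>m\<in>{- int N..<int N}. 1 - 1 / (1 - c * q powi m)) = of_nat N - S_part c N"
    and "(\<Sum>m\<in>J N. 1 - 1 / (1 - c * q powi m)) =
      of_nat N - S_part c N + (2 - 1 / (1 - c * q ^ N) - 1 / (1 - c * q ^ Suc N))"
proof -
  have nz: "1 - inverse c * q ^ Suc n \<noteq> 0" for n
    by (rule reflected_factor_nonzero[OF assms])
  show "(\<Sum>m\<in>{- int N..<int N}. 1 - 1 / (1 - c * q powi m)) = of_nat N - S_part c N"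
    unfolding sum_log_window[OF q0 assms(1) nz] S_part_def by (simp add: sum_subtractf)
  show "(\<Sum>m\<in>J N. 1 - 1 / (1 - c * q powi m)) =
      of_nat N - S_part c N + (2 - 1 / (1 - c * q ^ N) - 1 / (1 - c * q ^ Suc N))"
    unfolding J_def sum_log_window[OF q0 assms(1) nz] S_part_def by (simp add: sum_subtractf)
qed

lemma logder_eq:
  "logder N = 2 - (\<Sum>i=1..r. S_part (a i) N) + (\<Sum>k=0..s. S_part (b k) N)
     - (\<Sum>k=0..s. 2 - 1 / (1 - b k * q ^ N) - 1 / (1 - b k * q ^ Suc N))"
proof -
  have A: "(\<Sum>p\<in>{1..r} \<times> {- int N..<int N}. 1 - 1 / (1 - a (fst p) * q powi snd p)) =
      of_nat r * of_nat N - (\<Sum>i=1..r. S_part (a i) N)"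
  proof -
    have "(\<Sum>p\<in>{1..r} \<times> {- int N..<int N}. 1 - 1 / (1 - a (fst p) * q powi snd p)) =
        (\<Sum>i=1..r. \<Sum>m\<in>{- int N..<int N}. 1 - 1 / (1 - a i * q powi m))"
      unfolding sum.cartesian_product by (simp add: case_prod_beta)
    also have "\<dots> = (\<Sum>i=1..r. of_nat N - S_part (a i) N)"
      by (intro sum.cong refl log_window_eq(1) a0 a1)
    finally show ?thesis by (simp add: sum_subtractf)
  qed
  have B: "(\<Sum>p\<in>I N. 1 - 1 / (1 - x p)) = of_nat (s + 1) * of_nat N - (\<Sum>k=0..s. S_part (b k) N)
      + (\<Sum>k=0..s. 2 - 1 / (1 - b k * q ^ N) - 1 / (1 - b k * q ^ Suc N)) - 1"
  proof -
    \<comment> \<open>The added term at \<open>(0, 0)\<close> is \<open>1 - 1 / 0 = 1\<close>.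
      Together with the exponent of the prefactor \<open>t\<close> it makes the constant 2.\<close>
    have "(\<Sum>p\<in>{0..s} \<times> J N. 1 - 1 / (1 - x p)) =
        (1 - 1 / (1 - x (0, 0))) + (\<Sum>p\<in>I N. 1 - 1 / (1 - x p))"
      unfolding I_def using zero_in_J finite_J by (intro sum.remove) auto
    then have "(\<Sum>p\<in>I N. 1 - 1 / (1 - x p)) = (\<Sum>p\<in>{0..s} \<times> J N. 1 - 1 / (1 - x p)) - 1"
      by (simp add: x_00)
    also have "(\<Sum>p\<in>{0..s} \<times> J N. 1 - 1 / (1 - x p)) = (\<Sum>k=0..s. \<Sum>m\<in>J N. 1 - 1 / (1 - b k * q powi m))"
      unfolding sum.cartesian_product by (simp add: case_prod_beta x_def)
    also have "\<dots> = (\<Sum>k=0..s. of_nat N - S_part (b k) N + (2 - 1 / (1 - b k * q ^ N) - 1 / (1 - b k * q ^ Suc N)))"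
      by (rule sum.cong[OF refl], rule log_window_eq(2)) (use b0 node_factor_nonzero in auto)
    finally show ?thesis by (simp only: sum.distrib sum_subtractf) simp
  qed
  \<comment> \<open>The numbers of factors, which grow with \<open>N\<close>, cancel exactly against
    the exponent \<open>N * d\<close>.\<close>
  have "of_nat (s + 1) * of_nat N = (of_nat r * of_nat N + of_nat d * of_nat N :: complex)"
    unfolding d by (simp add: algebra_simps)
  then show ?thesis
    unfolding logder_def A B by (simp add: algebra_simps)
qed

lemma logder_tendsto:
  "logder \<longlonglongrightarrow> 1 - lambert_S q r a + lambert_S q s b"
proof -
  note q_pow = LIMSEQ_power_zero[OF q1]
  have S: "(\<lambda>N. S_part c N) \<longlonglongrightarrow> (\<Sum>n. 1 / (1 - c * q ^ n) - 1 / (1 - inverse c * q ^ Suc n))" for c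
    unfolding S_part_def by (rule lambert_S_partial[OF q1])
  have "(\<lambda>N. - (1 / (1 - q ^ N))) \<longlonglongrightarrow> - (1 / (1 - 0))"
    by (intro tendsto_intros q_pow) auto
  then have "(\<lambda>N. S_part (b 0) N) \<longlonglongrightarrow> - 1"
    unfolding b_0 S_part_one by simp
  moreover have "(\<lambda>N. \<Sum>k=1..s. S_part (b k) N) \<longlonglongrightarrow> lambert_S q s b"
    unfolding lambert_S_def by (intro tendsto_sum S)
  moreover have "(\<Sum>k=0..s. f k) = f 0 + (\<Sum>k=1..s. f k)" for f :: "nat \<Rightarrow> complex"
    by (simp add: sum.atLeast_Suc_atMost)
  ultimately have B: "(\<lambda>N. \<Sum>k=0..s. S_part (b k) N) \<longlonglongrightarrow> -1 + lambert_S q s b"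
    by (simp only:) (rule tendsto_add)
  have A: "(\<lambda>N. \<Sum>i=1..r. S_part (a i) N) \<longlonglongrightarrow> lambert_S q r a"
    unfolding lambert_S_def by (intro tendsto_sum S)
  have R: "(\<lambda>N. \<Sum>k=0..s. 2 - 1 / (1 - b k * q ^ N) - 1 / (1 - b k * q ^ Suc N)) \<longlonglongrightarrow>
      (\<Sum>k=0..s. 2 - 1 / (1 - b k * 0) - 1 / (1 - b k * 0))"
    by (intro tendsto_intros q_pow LIMSEQ_Suc[OF q_pow]) auto
  have "(\<lambda>N. logder N) \<longlonglongrightarrow> 2 - lambert_S q r a + (-1 + lambert_S q s b)
      - (\<Sum>k=0..s. 2 - 1 / (1 - b k * 0) - 1 / (1 - b k * 0))"
    unfolding logder_eq by (intro tendsto_intros A B R)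
  then show ?thesis by (simp add: algebra_simps)
qed

section \<open>Limits and uniform bounds of the corrections, and dominated convergence\<close>

definition E_lim :: "nat \<Rightarrow> complex" where
  "E_lim k = (\<Prod>i=1..r. qbracket q (a i / b k)) / (\<Prod>j\<in>{0..s} - {k}. qbracket q (b j / b k))"

lemma E_tendsto:
  assumes k: "k \<in> {0..s}"
  shows "(\<lambda>N. E N k n) \<longlonglongrightarrow> E_lim k / (qpoch_inf q q * qpoch_inf q q)"
proof -
  have num: "(\<lambda>N. nwin q (a i / b k) (int N + n) (int N - n)) \<longlonglongrightarrow> qbracket q (a i / b k)"
    if "i \<in> {1..r}" for i
    using nwin_tendsto[OF q0 q1, of "a i / b k" n "- n"] a0[OF that] b0[OF k] by simp
  have den: "(\<lambda>N. nwin q (b j / b k) (int N + n) (int (N + 2) - n)) \<longlonglongrightarrow> qbracket q (b j / b k)"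
    if "j \<in> {0..s} - {k}" for j
    using nwin_tendsto[OF q0 q1, of "b j / b k" n "2 - n"] b0[of j] b0[OF k] that by (simp add: algebra_simps)
  have Q: "(\<lambda>N. qpoch q q (nat (int (N + 1) - n))) \<longlonglongrightarrow> qpoch_inf q q"
    "(\<lambda>N. qpoch q q (nat (int N + n))) \<longlonglongrightarrow> qpoch_inf q q"
    using filterlim_compose[OF qpoch_tendsto[OF q1] filterlim_nat_add_const[of "1 - n"]]
      filterlim_compose[OF qpoch_tendsto[OF q1] filterlim_nat_add_const[of n]]
    by (simp_all add: algebra_simps)
  have "(\<lambda>N. E N k n) \<longlonglongrightarrow> (\<Prod>i=1..r. qbracket q (a i / b k)) /
      ((\<Prod>j\<in>{0..s} - {k}. qbracket q (b j / b k)) * (qpoch_inf q q * qpoch_inf q q))"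
    unfolding E_def using bb[OF _ k] qpoch_inf_self_nonzero[OF q1]
    by (intro tendsto_divide tendsto_mult tendsto_prod num den Q) auto
  then show ?thesis
    by (simp add: E_lim_def)
qed

definition bounded_on_J :: "(nat \<Rightarrow> int \<Rightarrow> complex) \<Rightarrow> bool" where
  "bounded_on_J f \<longleftrightarrow> (\<exists>C. \<forall>N. \<forall>n\<in>J N. cmod (f N n) \<le> C)"

lemma bounded_on_J_mult:
  assumes "bounded_on_J f" "bounded_on_J g"
  shows "bounded_on_J (\<lambda>N n. f N n * g N n)"
proof -
  obtain C D where "\<And>N n. n \<in> J N \<Longrightarrow> cmod (f N n) \<le> C" "\<And>N n. n \<in> J N \<Longrightarrow> cmod (g N n) \<le> D"
    using assms unfolding bounded_on_J_def by metis
  then have "cmod (f N n * g N n) \<le> C * D" if "n \<in> J N" for N n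
    unfolding norm_mult using that by (intro mult_mono') auto
  then show ?thesis unfolding bounded_on_J_def by blast
qed

lemma bounded_on_J_prod:
  assumes "\<And>i. i \<in> A \<Longrightarrow> bounded_on_J (f i)"
  shows "bounded_on_J (\<lambda>N n. \<Prod>i\<in>A. f i N n)"
  using assms
proof (induction A rule: infinite_finite_induct)
  case (insert i A)
  then show ?case by (simp add: bounded_on_J_mult)
qed (auto simp: bounded_on_J_def)

text \<open>For \<open>n\<close> in \<open>J N\<close> the left length \<open>N + n\<close> is
  nonnegative, the numerator end \<open>N - n\<close> is at least \<open>-1\<close>, and the
  denominator end \<open>N + 2 - n\<close> is at least 1; these are the ranges of the two window
  bounds.\<close>

lemma E_bounded:
  assumes k: "k \<in> {0..s}"
  shows "bounded_on_J (\<lambda>N n. E N k n)"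
proof -
  have num: "bounded_on_J (\<lambda>N n. nwin q (a i / b k) (int N + n) (int N - n))" if "i \<in> {1..r}" for i
  proof -
    have "a i / b k \<noteq> 0" using a0[OF that] b0[OF k] by simp
    from nwin_bounded[OF q0 q1 this] obtain C
      where "\<And>M L. 0 \<le> M \<Longrightarrow> - 1 \<le> L \<Longrightarrow> 0 \<le> M + L \<Longrightarrow> cmod (nwin q (a i / b k) M L) \<le> C"
      by metis
    then have "\<forall>N. \<forall>n\<in>J N. cmod (nwin q (a i / b k) (int N + n) (int N - n)) \<le> C"
      by (auto simp: J_def)
    then show ?thesis unfolding bounded_on_J_def by blast
  qed
  have den: "bounded_on_J (\<lambda>N n. inverse (nwin q (b j / b k) (int N + n) (int (N + 2) - n)))"
    if j: "j \<in> {0..s} - {k}" for j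
  proof -
    have "b j / b k \<noteq> 0" "qbracket q (b j / b k) \<noteq> 0"
      using b0[of j] b0[OF k] bb[of j k] j k by auto
    from nwin_inverse_bounded[OF q0 q1 this] obtain C
      where "\<And>M L. 0 \<le> M \<Longrightarrow> 0 \<le> L \<Longrightarrow> cmod (inverse (nwin q (b j / b k) M L)) \<le> C"
      by metis
    then have "\<forall>N. \<forall>n\<in>J N. cmod (inverse (nwin q (b j / b k) (int N + n) (int (N + 2) - n))) \<le> C"
      by (auto simp: J_def)
    then show ?thesis unfolding bounded_on_J_def by blast
  qed
  obtain C where "\<And>n. cmod (inverse (qpoch q q n)) \<le> C"
    using qpoch_inverse_bounded[OF q1 qpoch_inf_self_nonzero[OF q1]] by metis
  then have Q: "bounded_on_J (\<lambda>N n. inverse (qpoch q q (f N n)))" for f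
    unfolding bounded_on_J_def by blast
  have "bounded_on_J (\<lambda>N n. (\<Prod>i=1..r. nwin q (a i / b k) (int N + n) (int N - n)) *
      ((\<Prod>j\<in>{0..s} - {k}. inverse (nwin q (b j / b k) (int N + n) (int (N + 2) - n))) *
      (inverse (qpoch q q (nat (int (N + 1) - n))) * inverse (qpoch q q (nat (int N + n))))))"
    by (intro bounded_on_J_mult bounded_on_J_prod num den Q)
  then show ?thesis
    unfolding E_def by (simp add: divide_inverse prod_inversef[symmetric, unfolded o_def])
qed

text \<open>Extended by 0 outside \<open>J N\<close>, the terms are dominated by a constant times
  the Lambert terms, which do not depend on \<open>N\<close>.\<close>

lemma lambert_sum_tendsto:
  assumes k: "k \<in> {0..s}" and conv: "d = 0 \<Longrightarrow> cmod (q ^ 2) < cmod P \<and> cmod P < cmod q"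
  shows "(\<lambda>N. \<Sum>n\<in>J N. lambert_term q d (b k) (P * b k ^ d) n * E N k n) \<longlonglongrightarrow>
    (\<Sum>\<^sub>\<infinity>n. lambert_term q d (b k) (P * b k ^ d) n) * (E_lim k / (qpoch_inf q q * qpoch_inf q q))"
proof -
  define T where "T = lambert_term q d (b k) (P * b k ^ d)"
  define L where "L = E_lim k / (qpoch_inf q q * qpoch_inf q q)"
  have T: "(\<lambda>n. norm (T n)) summable_on UNIV"
    unfolding T_def using conv b0[OF k] P_nonzero node_factor_nonzero[OF k]
    by (intro lambert_term_summable q0 q1) auto
  obtain C where C: "\<And>N n. n \<in> J N \<Longrightarrow> cmod (E N k n) \<le> C"
    using E_bounded[OF k] unfolding bounded_on_J_def by blast
  have C0: "C \<ge> 0"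
    using C[OF zero_in_J] norm_ge_zero order_trans by blast
  have "(\<lambda>N. \<Sum>\<^sub>\<infinity>n. if n \<in> J N then T n * E N k n else 0) \<longlonglongrightarrow> (\<Sum>\<^sub>\<infinity>n. T n * L)"
  proof (rule infsum_dominated_tendsto)
    show "(\<lambda>n. norm (T n) * C) summable_on UNIV"
      using T by (rule summable_on_cmult_left)
    show "norm (if n \<in> J N then T n * E N k n else 0) \<le> norm (T n) * C" for n N
      using C[of n N] C0 by (auto simp: norm_mult intro: mult_left_mono)
    show "(\<lambda>N. if n \<in> J N then T n * E N k n else 0) \<longlonglongrightarrow> T n * L" for n
    proof -
      have "(\<lambda>N. T n * E N k n) \<longlonglongrightarrow> T n * L"
        unfolding L_def by (intro tendsto_intros E_tendsto[OF k])
      moreover have "\<forall>\<^sub>F N in sequentially. T n * E N k n = (if n \<in> J N then T n * E N k n else 0)"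
        by (rule eventually_sequentiallyI[of "nat \<bar>n\<bar>"]) (auto simp: J_def)
      ultimately show ?thesis
        by (rule Lim_transform_eventually)
    qed
  qed
  moreover have "(\<Sum>\<^sub>\<infinity>n. if n \<in> J N then T n * E N k n else 0) = (\<Sum>n\<in>J N. T n * E N k n)" for N
  proof -
    have "(\<Sum>\<^sub>\<infinity>n. if n \<in> J N then T n * E N k n else 0) = (\<Sum>\<^sub>\<infinity>n\<in>J N. T n * E N k n)"
      by (rule infsum_cong_neutral) auto
    then show ?thesis using finite_J by simp
  qed
  moreover have "(\<Sum>\<^sub>\<infinity>n. T n * L) = (\<Sum>\<^sub>\<infinity>n. T n) * L"
    by (rule infsum_cmult_left')
  ultimately show ?thesis
    unfolding T_def[symmetric] L_def[symmetric] by simp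
qed

lemma limit_identity:
  assumes conv: "d = 0 \<Longrightarrow> cmod (q ^ 2) < cmod P \<and> cmod P < cmod q"
  shows "E_lim 0 * (1 - lambert_S q r a + lambert_S q s b) =
    - (\<Sum>k=0..s. E_lim k / b k * (\<Sum>\<^sub>\<infinity>n. lambert_term q d (b k) (P * b k ^ d) n))"
proof -
  \<comment> \<open>The limit of the punctured windows; it is the same for every \<open>k\<close>
    and cancels.\<close>
  define Q where "Q = qpoch_inf q q * qpoch_inf q q"
  have "Q \<noteq> 0"
    unfolding Q_def using qpoch_inf_self_nonzero[OF q1] by simp
  have "(\<lambda>N. E N 0 0 * logder N) \<longlonglongrightarrow> E_lim 0 / Q * (1 - lambert_S q r a + lambert_S q s b)"
    unfolding Q_def by (intro tendsto_mult E_tendsto logder_tendsto) simp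
  moreover have "(\<lambda>N. E N 0 0 * logder N) \<longlonglongrightarrow>
      - (\<Sum>k=0..s. (1 / b k) * ((\<Sum>\<^sub>\<infinity>n. lambert_term q d (b k) (P * b k ^ d) n) * (E_lim k / Q)))"
    unfolding finite_identity Q_def
    by (intro tendsto_minus tendsto_sum tendsto_mult tendsto_const lambert_sum_tendsto conv) auto
  ultimately have "E_lim 0 / Q * (1 - lambert_S q r a + lambert_S q s b) =
      - (\<Sum>k=0..s. (1 / b k) * ((\<Sum>\<^sub>\<infinity>n. lambert_term q d (b k) (P * b k ^ d) n) * (E_lim k / Q)))"
    by (rule LIMSEQ_unique)
  also have "\<dots> = - (\<Sum>k=0..s. E_lim k / b k * (\<Sum>\<^sub>\<infinity>n. lambert_term q d (b k) (P * b k ^ d) n)) / Q"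
    by (simp add: sum_divide_distrib mult_ac)
  finally show ?thesis
    using \<open>Q \<noteq> 0\<close> by (simp only: times_divide_eq_left divide_cancel_right simp_thms)
qed

end

section \<open>Separation of the row of \<open>b_0 = 1\<close> from the symmetric identity\<close>

theorem theorem2p3:
  fixes q :: complex and r s :: nat and a b :: "nat \<Rightarrow> complex"
  assumes q: "0 < cmod q" "cmod q < 1"
    and rs: "r \<le> s \<or>
      (r = s + 1 \<and> cmod (q ^ 2) < cmod ((\<Prod>i=1..r. a i) / (\<Prod>j=1..s. b j)) \<and>
       cmod ((\<Prod>i=1..r. a i) / (\<Prod>j=1..s. b j)) < cmod q)"
    and a_nz: "\<And>i. i \<in> {1..r} \<Longrightarrow> a i \<noteq> 0"
    and b_nz: "\<And>k. k \<in> {1..s} \<Longrightarrow> b k \<noteq> 0"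
    and S_a_defined: "\<And>i n. i \<in> {1..r} \<Longrightarrow>
      1 - a i * q ^ n \<noteq> 0 \<and> 1 - inverse (a i) * q ^ Suc n \<noteq> 0"
    and S_b_defined: "\<And>k n. k \<in> {1..s} \<Longrightarrow>
      1 - b k * q ^ n \<noteq> 0 \<and> 1 - inverse (b k) * q ^ Suc n \<noteq> 0"
    and bracket_b_nz: "\<And>k. k \<in> {1..s} \<Longrightarrow> qbracket q (b k) \<noteq> 0"
    and bracket_bb_nz: "\<And>j k. j \<in> {1..s} \<Longrightarrow> k \<in> {1..s} \<Longrightarrow> j \<noteq> k \<Longrightarrow>
      qbracket q (b j / b k) \<noteq> 0"
    and denom_b_nz: "\<And>k (n::int). k \<in> {1..s} \<Longrightarrow> 1 - b k * q powi n \<noteq> 0"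
  shows "(\<Prod>i=1..r. qbracket q (a i)) / (\<Prod>j=1..s. qbracket q (b j)) *
           (1 - lambert_S q r a + lambert_S q s b)
       + (\<Prod>i=1..r. qbracket q (a i)) / (\<Prod>j=1..s. qbracket q (b j)) *
           (\<Sum>\<^sub>\<infinity>n\<in>UNIV - {0::int}.
              lambert_coeff q (int s - int r + 1) n / (1 - q powi n) *
              ((\<Prod>i=1..r. a i) / (\<Prod>j=1..s. b j)) powi n)
       = (\<Sum>k=1..s.
            (\<Prod>i=1..r. qbracket q (a i / b k)) /
            (qbracket q (b k) * (\<Prod>j\<in>{1..s} - {k}. qbracket q (b j / b k))) *
            (\<Sum>\<^sub>\<infinity>n\<in>(UNIV :: int set).
               lambert_coeff q (int s - int r + 1) n / (1 - b k * q powi n) *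
               ((\<Prod>i=1..r. a i) * b k powi (int s - int r) /
                (\<Prod>j\<in>{1..s} - {k}. b j)) powi n))"
proof -
  define d where "d = s + 1 - r"
  \<comment> \<open>Only \<open>b\<close> on \<open>{1..s}\<close> is meaningful, so the index 0 is
    free for the auxiliary parameter 1.\<close>
  define \<beta> where "\<beta> = b(0 := 1)"
  have rd: "s + 1 = r + d"
    using rs by (auto simp: d_def)
  have q0: "q \<noteq> 0" using q by auto
  have \<beta>: "\<beta> 0 = 1" "\<And>k. k \<in> {1..s} \<Longrightarrow> \<beta> k = b k"
    by (auto simp: \<beta>_def)
  interpret lambert_data q r s d a \<beta>
  proof
    show "q \<noteq> 0" "cmod q < 1" "s + 1 = r + d" "\<beta> 0 = 1"
      using q0 q rd \<beta> by auto
    show "a i \<noteq> 0" if "i \<in> {1..r}" for i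
      using a_nz[OF that] .
    show "1 - a i * q powi m \<noteq> 0" if i: "i \<in> {1..r}" for i m
    proof (cases "m \<ge> 0")
      case True
      then show ?thesis
        using S_a_defined[OF i, of "nat m"] by (simp add: power_int_def)
    next
      case False
      define n where "n = nat (- m - 1)"
      have m: "m = - int (Suc n)" using False by (simp add: n_def)
      have "a i \<noteq> q ^ Suc n"
        using S_a_defined[OF i, of n] a_nz[OF i] by (auto simp: field_simps)
      then show ?thesis
        unfolding m power_int_minus power_int_of_nat using q0 by (simp add: field_simps)
    qed
    show "\<beta> k \<noteq> 0" if "k \<in> {0..s}" for k
      using that b_nz by (cases "k = 0") (auto simp: \<beta>_def)
    \<comment> \<open>With \<open>j = 0\<close> the quotient is \<open>1 / b k\<close>, whose
      bracket is a nonzero multiple of that of \<open>b k\<close>.\<close>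
    show "qbracket q (\<beta> j / \<beta> k) \<noteq> 0" if "j \<in> {0..s}" "k \<in> {0..s}" "j \<noteq> k" for j k
      using that bracket_b_nz bracket_bb_nz b_nz qbracket_inverse[OF q(2), of "b k"]
      by (cases "j = 0"; cases "k = 0") (auto simp: \<beta>_def)
  qed
  have split: "{0..s} = insert 0 {1..s}" by auto
  have prod_\<beta>: "(\<Prod>j=1..s. f (\<beta> j)) = (\<Prod>j=1..s. f (b j))" for f :: "complex \<Rightarrow> complex"
    using \<beta>(2) by (intro prod.cong) auto
  have P: "P = (\<Prod>i=1..r. a i) / (\<Prod>j=1..s. b j)"
    unfolding P_def split using \<beta>(1) prod_\<beta>[of "\<lambda>z. z"] by simp
  have int_d: "int s - int r + 1 = int d"
    using rd by linarith
  have S: "lambert_S q s \<beta> = lambert_S q s b"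
    unfolding lambert_S_def using \<beta>(2) by (intro sum.cong) auto
  define B where "B = (\<Prod>i=1..r. qbracket q (a i)) / (\<Prod>j=1..s. qbracket q (b j))"
  have E0: "E_lim 0 = B"
  proof -
    have "{0..s} - {0} = {1..s}" by auto
    then show ?thesis
      unfolding E_lim_def B_def using \<beta>(1) prod_\<beta>[of "qbracket q"] by simp
  qed
  have Ek: "E_lim k / \<beta> k = - ((\<Prod>i=1..r. qbracket q (a i / b k)) /
      (qbracket q (b k) * (\<Prod>j\<in>{1..s} - {k}. qbracket q (b j / b k))))" if k: "k \<in> {1..s}" for k
  proof -
    have "{0..s} - {k} = insert 0 ({1..s} - {k})" using k by auto
    moreover have "(\<Prod>j\<in>{1..s} - {k}. qbracket q (\<beta> j / \<beta> k)) = (\<Prod>j\<in>{1..s} - {k}. qbracket q (b j / b k))"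
      using \<beta>(2) k by (intro prod.cong) auto
    ultimately have "E_lim k = (\<Prod>i=1..r. qbracket q (a i / b k)) /
        (qbracket q (1 / b k) * (\<Prod>j\<in>{1..s} - {k}. qbracket q (b j / b k)))"
      unfolding E_lim_def using \<beta> k by simp
    then show ?thesis
      unfolding qbracket_inverse[OF q(2) b_nz[OF k]] \<beta>(2)[OF k] using b_nz[OF k] by simp
  qed
  have X: "P * \<beta> k ^ d = (\<Prod>i=1..r. a i) * b k powi (int s - int r) / (\<Prod>j\<in>{1..s} - {k}. b j)"
    if k: "k \<in> {1..s}" for k
  proof -
    \<comment> \<open>The integer power is needed because \<open>s - r\<close> is \<open>-1\<close>
      when \<open>r = s + 1\<close>.\<close>
    have "b k ^ d = b k powi (int s - int r) * b k"
      using power_int_add_1[of "b k" "int s - int r"] b_nz[OF k] unfolding int_d by simp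
    moreover have "(\<Prod>j=1..s. b j) = b k * (\<Prod>j\<in>{1..s} - {k}. b j)"
      using k by (intro prod.remove) auto
    ultimately show ?thesis
      unfolding P \<beta>(2)[OF k] using b_nz[OF k] by simp
  qed
  have sum0: "(\<Sum>\<^sub>\<infinity>n. lambert_term q d (\<beta> 0) (P * \<beta> 0 ^ d) n) =
      (\<Sum>\<^sub>\<infinity>n\<in>UNIV - {0}. lambert_coeff q (int d) n / (1 - q powi n) * P powi n)"
    by (rule infsum_cong_neutral) (auto simp: lambert_term_def \<beta>)
  have conv: "cmod (q ^ 2) < cmod P \<and> cmod P < cmod q" if "d = 0"
    using rs that rd unfolding P by auto
  have "B * (1 - lambert_S q r a + lambert_S q s b) =
      - (\<Sum>k=0..s. E_lim k / \<beta> k * (\<Sum>\<^sub>\<infinity>n. lambert_term q d (\<beta> k) (P * \<beta> k ^ d) n))"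
    using limit_identity[OF conv] unfolding E0 S .
  also have "(\<Sum>k=0..s. E_lim k / \<beta> k * (\<Sum>\<^sub>\<infinity>n. lambert_term q d (\<beta> k) (P * \<beta> k ^ d) n)) =
      B * (\<Sum>\<^sub>\<infinity>n\<in>UNIV - {0}. lambert_coeff q (int d) n / (1 - q powi n) * P powi n) +
      (\<Sum>k=1..s. E_lim k / \<beta> k * (\<Sum>\<^sub>\<infinity>n. lambert_term q d (\<beta> k) (P * \<beta> k ^ d) n))"
    unfolding split using sum0 E0 \<beta>(1) by simp
  also have "(\<Sum>k=1..s. E_lim k / \<beta> k * (\<Sum>\<^sub>\<infinity>n. lambert_term q d (\<beta> k) (P * \<beta> k ^ d) n)) =
      - (\<Sum>k=1..s.
            (\<Prod>i=1..r. qbracket q (a i / b k)) /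
            (qbracket q (b k) * (\<Prod>j\<in>{1..s} - {k}. qbracket q (b j / b k))) *
            (\<Sum>\<^sub>\<infinity>n. lambert_coeff q (int d) n / (1 - b k * q powi n) *
               ((\<Prod>i=1..r. a i) * b k powi (int s - int r) / (\<Prod>j\<in>{1..s} - {k}. b j)) powi n))"
    unfolding sum_negf[symmetric]
  proof (rule sum.cong[OF refl])
    fix k assume k: "k \<in> {1..s}"
    show "E_lim k / \<beta> k * (\<Sum>\<^sub>\<infinity>n. lambert_term q d (\<beta> k) (P * \<beta> k ^ d) n) =
        - ((\<Prod>i=1..r. qbracket q (a i / b k)) /
            (qbracket q (b k) * (\<Prod>j\<in>{1..s} - {k}. qbracket q (b j / b k))) *
            (\<Sum>\<^sub>\<infinity>n. lambert_coeff q (int d) n / (1 - b k * q powi n) *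
               ((\<Prod>i=1..r. a i) * b k powi (int s - int r) / (\<Prod>j\<in>{1..s} - {k}. b j)) powi n))"
      unfolding Ek[OF k] X[OF k] unfolding lambert_term_def \<beta>(2)[OF k] mult_minus_left ..
  qed
  finally show ?thesis
    unfolding int_d P[symmetric] B_def[symmetric] by (simp add: algebra_simps)
qed

end
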